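(* Let $M$ be a closed connected Riemannian manifold, let $\|\cdot\|$ be a norm on the finite-dimensional space $H_1(M;\mathbb R)$, and let $X$ be a continuous semimartingale on $M$. If $H_t$ and $\widetilde H_t$ are the homology classes obtained from $X$ by means of two Borel closing families of uniformly bounded length, then $$\sup_{t\ge0}\|H_t-\widetilde H_t\|<\infty .$$ Every asymptotic statement unchanged by a bounded perturbation is therefore independent of the chosen closing family.
   Context: A continuous semimartingale on $M$ is a continuous $M$-valued process that in local coordinates is the sum of a continuous local martingale and a continuous finite-variation process. A Borel closing family of uniformly bounded length is a family of piecewise smooth paths $\gamma_{x,y}:[0,1]\to M$, $x,y\in M$, with $\gamma_{x,y}$ joining $x$ to $y$, depending on $(x,y)$ in a Borel way, and such that $\operatorname{length}(\gamma_{x,y})\le L$ for all $x,y\in M$, for some constant $L<\infty$. Given such a family, a continuous path $X:[0,\infty)\to M$ and $t>0$, let $\Gamma(X,t)$ be the closed path obtained by following $X_s$, $0\le s\le t$, and then $\gamma_{X_t,X_0}$ from $X_t$ back to $X_0$. Then $H_t=H_t(X)=[\Gamma(X,t)]\in H_1(M;\mathbb R)$ is its singular homology class, with $H_0=0$; $\widetilde H_t$ is defined in the same way from the second closing family. *)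

theory Defs
  imports "HOL-Probability.Probability" "HOL-Homology.Homology"
begin

section \<open>Singular homology with real coefficients\<close>

text \<open>
  The simplices and their faces are those of \<^theory>\<open>HOL-Homology.Simplices\<close>, whose chains have
  integer coefficients. An element of homology is a coset of the space of boundaries.
\<close>

type_synonym 'a rchain = "((nat \<Rightarrow> real) \<Rightarrow> 'a) \<Rightarrow>\<^sub>0 real"

definition real_chains :: "nat \<Rightarrow> 'a topology \<Rightarrow> 'a rchain set" where
  "real_chains p X = {c. Poly_Mapping.keys c \<subseteq> singular_simplex_set p X}"

definition real_boundary :: "nat \<Rightarrow> 'a rchain \<Rightarrow> 'a rchain" where
  "real_boundary p c =
     (if p = 0 then 0
      else \<Sum>f\<in>Poly_Mapping.keys c. \<Sum>k\<le>p.
             Poly_Mapping.single (singular_face p k f) ((-1) ^ k * Poly_Mapping.lookup c f))"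

definition real_cycles :: "nat \<Rightarrow> 'a topology \<Rightarrow> 'a rchain set" where
  "real_cycles p X = {c \<in> real_chains p X. real_boundary p c = 0}"

definition real_boundaries :: "nat \<Rightarrow> 'a topology \<Rightarrow> 'a rchain set" where
  "real_boundaries p X = real_boundary (Suc p) ` real_chains (Suc p) X"

definition homology_class :: "nat \<Rightarrow> 'a topology \<Rightarrow> 'a rchain \<Rightarrow> 'a rchain set" where
  "homology_class p X z = {z + b | b. b \<in> real_boundaries p X}"

definition real_homology :: "nat \<Rightarrow> 'a topology \<Rightarrow> 'a rchain set set" where
  "real_homology p X = homology_class p X ` real_cycles p X"

definition homology_zero :: "nat \<Rightarrow> 'a topology \<Rightarrow> 'a rchain set" where
  "homology_zero p X = homology_class p X 0"

definition homology_add :: "'a rchain set \<Rightarrow> 'a rchain set \<Rightarrow> 'a rchain set" where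
  "homology_add A B = {a + b | a b. a \<in> A \<and> b \<in> B}"

definition homology_diff :: "'a rchain set \<Rightarrow> 'a rchain set \<Rightarrow> 'a rchain set" where
  "homology_diff A B = {a - b | a b. a \<in> A \<and> b \<in> B}"

text \<open>Adding the boundaries makes the definition correct also for the scalar \<open>0\<close>.\<close>

definition homology_scale :: "nat \<Rightarrow> 'a topology \<Rightarrow> real \<Rightarrow> 'a rchain set \<Rightarrow> 'a rchain set" where
  "homology_scale p X r A =
     {Poly_Mapping.map ((*) r) a + b | a b. a \<in> A \<and> b \<in> real_boundaries p X}"

definition homology_norm :: "nat \<Rightarrow> 'a topology \<Rightarrow> ('a rchain set \<Rightarrow> real) \<Rightarrow> bool" where
  "homology_norm p X N \<longleftrightarrow>
     (\<forall>h\<in>real_homology p X. 0 \<le> N h \<and> (N h = 0 \<longleftrightarrow> h = homology_zero p X)) \<and>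
     (\<forall>h\<in>real_homology p X. \<forall>r. N (homology_scale p X r h) = \<bar>r\<bar> * N h) \<and>
     (\<forall>h\<in>real_homology p X. \<forall>k\<in>real_homology p X. N (homology_add h k) \<le> N h + N k)"

text \<open>
  A path on \<open>[0,1]\<close> is regarded as a singular 1-simplex through the second barycentric coordinate.
\<close>

definition path_simplex :: "(real \<Rightarrow> 'a) \<Rightarrow> (nat \<Rightarrow> real) \<Rightarrow> 'a" where
  "path_simplex g = restrict (\<lambda>u. g (u 1)) (standard_simplex 1)"

definition path_class :: "'a topology \<Rightarrow> (real \<Rightarrow> 'a) \<Rightarrow> 'a rchain set" where
  "path_class X g = homology_class 1 X (Poly_Mapping.single (path_simplex g) 1)"

lemma path_simplex_in_real_cycles:
  assumes "pathin X g" "g 0 = g 1"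
  shows "Poly_Mapping.single (path_simplex g) 1 \<in> real_cycles 1 X"
proof -
  have "continuous_map (subtopology (powertop_real UNIV) (standard_simplex 1))
          (top_of_set {0..1}) (\<lambda>u. u 1)"
    by (auto simp: continuous_map_in_subtopology standard_simplex_def
        intro!: continuous_map_from_subtopology continuous_map_product_projection)
  then have "continuous_map (subtopology (powertop_real UNIV) (standard_simplex 1)) X (\<lambda>u. g (u 1))"
    using assms(1) continuous_map_compose unfolding pathin_def comp_def by fastforce
  then have "singular_simplex 1 X (path_simplex g)"
    unfolding singular_simplex_def path_simplex_def
    by (auto intro: continuous_map_eq)
  moreover have "singular_face 1 0 (path_simplex g) u = singular_face 1 1 (path_simplex g) u" for u
    using assms(2) simplical_face_in_standard_simplex[of 1 _ u]
    by (auto simp: singular_face_def path_simplex_def standard_simplex_0 simplical_face_def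
        standard_simplex_def restrict_def)
  then have "singular_face 1 0 (path_simplex g) = singular_face 1 1 (path_simplex g)" by blast
  ultimately show ?thesis
    by (simp add: real_cycles_def real_chains_def real_boundary_def flip: single_add)
qed


section \<open>Closed Riemannian manifolds\<close>

text \<open>
  Iterated directional derivatives; on open subsets of a finite-dimensional space this is the
  usual notion of class \<open>C\<^sup>k\<close>.
\<close>

primrec C_k_on :: "nat \<Rightarrow> 'a::real_normed_vector set \<Rightarrow> ('a \<Rightarrow> 'b::real_normed_vector) \<Rightarrow> bool" where
  "C_k_on 0 S f \<longleftrightarrow> continuous_on S f"
| "C_k_on (Suc k) S f \<longleftrightarrow>
     (\<forall>x\<in>S. f differentiable (at x)) \<and> (\<forall>v. C_k_on k S (\<lambda>x. frechet_derivative f (at x) v))"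

definition smooth_map_on :: "'a::real_normed_vector set \<Rightarrow> ('a \<Rightarrow> 'b::real_normed_vector) \<Rightarrow> bool" where
  "smooth_map_on S f \<longleftrightarrow> (\<forall>k. C_k_on k S f)"

text \<open>
  A chart is a pair of its domain and its coordinate map; the values of the latter outside the
  domain are irrelevant. The model space is a finite-dimensional real inner product space. The
  class \<open>real_inner\<close> is used instead of \<open>euclidean_space\<close> because the latter excludes dimension \<open>0\<close>.
\<close>

type_synonym ('a, 'e) chart = "'a set \<times> ('a \<Rightarrow> 'e)"

definition transition :: "('a, 'e) chart \<Rightarrow> ('a, 'e) chart \<Rightarrow> 'e \<Rightarrow> 'e" where
  "transition c d = snd d \<circ> inv_into (fst c) (snd c)"

definition smooth_atlas :: "'a topology \<Rightarrow> ('a, 'e::real_inner) chart set \<Rightarrow> bool" where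
  "smooth_atlas M \<A> \<longleftrightarrow>
     (\<exists>B::'e set. finite B \<and> span B = UNIV) \<and>
     \<Union>(fst ` \<A>) = topspace M \<and>
     (\<forall>(U, \<phi>)\<in>\<A>. openin M U \<and> open (\<phi> ` U) \<and>
        homeomorphic_map (subtopology M U) (top_of_set (\<phi> ` U)) \<phi>) \<and>
     (\<forall>c\<in>\<A>. \<forall>d\<in>\<A>. smooth_map_on (snd c ` (fst c \<inter> fst d)) (transition c d))"

definition closed_manifold :: "'a topology \<Rightarrow> ('a, 'e::real_inner) chart set \<Rightarrow> bool" where
  "closed_manifold M \<A> \<longleftrightarrow>
     Hausdorff_space M \<and> second_countable M \<and> compact_space M \<and> smooth_atlas M \<A>"

text \<open>
  \<open>g c p v w\<close> is the inner product at the point \<open>p\<close> of the tangent vectors which have the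
  components \<open>v\<close> and \<open>w\<close> with respect to the chart \<open>c\<close>.
\<close>

type_synonym ('a, 'e) metric_field = "('a, 'e) chart \<Rightarrow> 'a \<Rightarrow> 'e \<Rightarrow> 'e \<Rightarrow> real"

definition riemannian_metric ::
    "('a, 'e::real_inner) chart set \<Rightarrow> ('a, 'e) metric_field \<Rightarrow> bool" where
  "riemannian_metric \<A> g \<longleftrightarrow>
     (\<forall>c\<in>\<A>. \<forall>p\<in>fst c.
        bilinear (g c p) \<and> (\<forall>v w. g c p v w = g c p w v) \<and> (\<forall>v. v \<noteq> 0 \<longrightarrow> 0 < g c p v v)) \<and>
     (\<forall>c\<in>\<A>. \<forall>v w. smooth_map_on (snd c ` fst c) (\<lambda>x. g c (inv_into (fst c) (snd c) x) v w)) \<and>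
     (\<forall>c\<in>\<A>. \<forall>d\<in>\<A>. \<forall>p\<in>fst c \<inter> fst d. \<forall>v w.
        g c p v w = g d p (frechet_derivative (transition c d) (at (snd c p)) v)
                          (frechet_derivative (transition c d) (at (snd c p)) w))"

definition closed_connected_riemannian_manifold ::
    "'a topology \<Rightarrow> ('a, 'e::real_inner) chart set \<Rightarrow> ('a, 'e) metric_field \<Rightarrow> bool" where
  "closed_connected_riemannian_manifold M \<A> g \<longleftrightarrow>
     closed_manifold M \<A> \<and> connected_space M \<and> riemannian_metric \<A> g"


section \<open>Piecewise smooth paths and closing families\<close>

text \<open>
  Smoothness of a curve on a compact interval: in every chart all derivatives exist, one-sided
  ones at the end points. The sequence \<open>D\<close> lists the successive derivatives.
\<close>

definition smooth_curve_on ::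
    "('a, 'e::real_inner) chart set \<Rightarrow> real \<Rightarrow> real \<Rightarrow> (real \<Rightarrow> 'a) \<Rightarrow> bool" where
  "smooth_curve_on \<A> a b \<gamma> \<longleftrightarrow>
     (\<forall>(U, \<phi>)\<in>\<A>. let S = {s \<in> {a..b}. \<gamma> s \<in> U} in
        \<exists>D :: nat \<Rightarrow> real \<Rightarrow> 'e.
          (\<forall>s\<in>S. D 0 s = \<phi> (\<gamma> s)) \<and>
          (\<forall>k. \<forall>s\<in>S. (D k has_vector_derivative D (Suc k) s) (at s within S)))"

text \<open>\<open>B\<close> contains the break points.\<close>

definition piecewise_smooth_path ::
    "'a topology \<Rightarrow> ('a, 'e::real_inner) chart set \<Rightarrow> (real \<Rightarrow> 'a) \<Rightarrow> bool" where
  "piecewise_smooth_path M \<A> \<gamma> \<longleftrightarrow>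
     pathin M \<gamma> \<and>
     (\<exists>B. finite B \<and>
        (\<forall>a b. 0 \<le> a \<and> a < b \<and> b \<le> 1 \<and> {a<..<b} \<inter> B = {} \<longrightarrow> smooth_curve_on \<A> a b \<gamma>))"

text \<open>
  By the transformation law of the metric the speed does not depend on the chart that is chosen
  around the point. At the finitely many break points its value is irrelevant for the length.
\<close>

definition riemannian_speed ::
    "('a, 'e::real_inner) chart set \<Rightarrow> ('a, 'e) metric_field \<Rightarrow> (real \<Rightarrow> 'a) \<Rightarrow> real \<Rightarrow> real" where
  "riemannian_speed \<A> g \<gamma> s =
     (let c = (SOME c. c \<in> \<A> \<and> \<gamma> s \<in> fst c);
          v = vector_derivative (snd c \<circ> \<gamma>) (at s)
      in sqrt (g c (\<gamma> s) v v))"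

definition riemannian_length ::
    "('a, 'e::real_inner) chart set \<Rightarrow> ('a, 'e) metric_field \<Rightarrow> (real \<Rightarrow> 'a) \<Rightarrow> real" where
  "riemannian_length \<A> g \<gamma> = integral {0..1} (riemannian_speed \<A> g \<gamma>)"

definition borel_algebra :: "'a topology \<Rightarrow> 'a measure" where
  "borel_algebra X = sigma (topspace X) {U. openin X U}"

text \<open>
  The Borel dependence on the end points is that of all evaluations; these generate the Borel
  \<open>\<sigma>\<close>-algebra of the space of continuous paths in \<open>M\<close> with the uniform topology.
\<close>

definition borel_closing_family ::
    "'a topology \<Rightarrow> ('a, 'e::real_inner) chart set \<Rightarrow> ('a, 'e) metric_field
      \<Rightarrow> ('a \<Rightarrow> 'a \<Rightarrow> real \<Rightarrow> 'a) \<Rightarrow> bool" where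
  "borel_closing_family M \<A> g \<gamma> \<longleftrightarrow>
     (\<forall>x\<in>topspace M. \<forall>y\<in>topspace M.
        piecewise_smooth_path M \<A> (\<gamma> x y) \<and> \<gamma> x y 0 = x \<and> \<gamma> x y 1 = y) \<and>
     (\<forall>s\<in>{0..1}. (\<lambda>(x, y). \<gamma> x y s) \<in> borel_algebra (prod_topology M M) \<rightarrow>\<^sub>M borel_algebra M) \<and>
     (\<exists>L. \<forall>x\<in>topspace M. \<forall>y\<in>topspace M. riemannian_length \<A> g (\<gamma> x y) \<le> L)"

definition closed_up_path ::
    "('a \<Rightarrow> 'a \<Rightarrow> real \<Rightarrow> 'a) \<Rightarrow> (real \<Rightarrow> 'a) \<Rightarrow> real \<Rightarrow> real \<Rightarrow> 'a" where
  "closed_up_path \<gamma> x t s =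
     (if s \<le> 1 / 2 then x (2 * s * t) else \<gamma> (x t) (x 0) (2 * s - 1))"

definition closing_class ::
    "'a topology \<Rightarrow> ('a \<Rightarrow> 'a \<Rightarrow> real \<Rightarrow> 'a) \<Rightarrow> (real \<Rightarrow> 'a) \<Rightarrow> real \<Rightarrow> 'a rchain set" where
  "closing_class M \<gamma> x t =
     (if t = 0 then homology_zero 1 M else path_class M (closed_up_path \<gamma> x t))"


section \<open>Continuous semimartingales\<close>

text \<open>
  Processes \<open>X t \<omega>\<close> have the time set \<open>{0..}\<close>; their values at negative times are ignored. The
  filtration is nevertheless indexed by all reals, so that the library notions of filtration and
  stopping time apply; a filtration on \<open>{0..}\<close> is extended by \<open>F t = F 0\<close> for \<open>t < 0\<close>.
\<close>

definition filtered_prob_space :: "'w measure \<Rightarrow> (real \<Rightarrow> 'w measure) \<Rightarrow> bool" where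
  "filtered_prob_space P F \<longleftrightarrow>
     prob_space P \<and> filtration (space P) F \<and> (\<forall>t. subalgebra P (F t))"

definition continuous_adapted ::
    "'w measure \<Rightarrow> (real \<Rightarrow> 'w measure) \<Rightarrow> 'a topology \<Rightarrow> (real \<Rightarrow> 'w \<Rightarrow> 'a) \<Rightarrow> bool" where
  "continuous_adapted P F M X \<longleftrightarrow>
     (\<forall>t\<ge>0. X t \<in> F t \<rightarrow>\<^sub>M borel_algebra M) \<and>
     (\<forall>\<omega>\<in>space P. continuous_map (top_of_set {0..}) M (\<lambda>t. X t \<omega>))"

definition martingale ::
    "'w measure \<Rightarrow> (real \<Rightarrow> 'w measure) \<Rightarrow> (real \<Rightarrow> 'w \<Rightarrow> real) \<Rightarrow> bool" where
  "martingale P F Z \<longleftrightarrow>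
     (\<forall>t\<ge>0. Z t \<in> borel_measurable (F t) \<and> integrable P (Z t)) \<and>
     (\<forall>s t. 0 \<le> s \<and> s \<le> t \<longrightarrow> (AE \<omega> in P. real_cond_exp P (F s) (Z t) \<omega> = Z s \<omega>))"

definition continuous_local_martingale ::
    "'w measure \<Rightarrow> (real \<Rightarrow> 'w measure) \<Rightarrow> (real \<Rightarrow> 'w \<Rightarrow> real) \<Rightarrow> bool" where
  "continuous_local_martingale P F Z \<longleftrightarrow>
     continuous_adapted P F euclideanreal Z \<and>
     (\<exists>T :: nat \<Rightarrow> 'w \<Rightarrow> real.
        (\<forall>n. stopping_time F (T n)) \<and>
        (\<forall>n. \<forall>\<omega>\<in>space P. 0 \<le> T n \<omega> \<and> T n \<omega> \<le> T (Suc n) \<omega>) \<and>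
        (AE \<omega> in P. filterlim (\<lambda>n. T n \<omega>) at_top sequentially) \<and>
        (\<forall>n. martingale P F (\<lambda>t \<omega>. Z (min t (T n \<omega>)) \<omega> - Z 0 \<omega>)))"

definition continuous_finite_variation ::
    "'w measure \<Rightarrow> (real \<Rightarrow> 'w measure) \<Rightarrow> (real \<Rightarrow> 'w \<Rightarrow> real) \<Rightarrow> bool" where
  "continuous_finite_variation P F A \<longleftrightarrow>
     continuous_adapted P F euclideanreal A \<and>
     (\<forall>\<omega>\<in>space P. \<forall>t\<ge>0. \<exists>C. \<forall>n. \<forall>q :: nat \<Rightarrow> real.
        mono q \<and> range q \<subseteq> {0..t} \<longrightarrow> (\<Sum>k<n. \<bar>A (q (Suc k)) \<omega> - A (q k) \<omega>\<bar>) \<le> C)"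

definition real_semimartingale ::
    "'w measure \<Rightarrow> (real \<Rightarrow> 'w measure) \<Rightarrow> (real \<Rightarrow> 'w \<Rightarrow> real) \<Rightarrow> bool" where
  "real_semimartingale P F Z \<longleftrightarrow>
     (\<exists>N A. continuous_local_martingale P F N \<and> continuous_finite_variation P F A \<and>
        (\<forall>t\<ge>0. \<forall>\<omega>\<in>space P. Z t \<omega> = N t \<omega> + A t \<omega>))"

text \<open>
  Since \<open>X\<close> may leave the domain of a chart, its coordinates are considered on the stochastic
  intervals \<open>[S, T]\<close> during which \<open>X\<close> stays in the domain, through their increments since time \<open>S\<close>.
  These vanish before \<open>S\<close> (in particular everywhere if \<open>S \<omega> = T \<omega>\<close>) and are constant after \<open>T\<close>.
  The coordinates are the linear functionals \<open>\<lambda>x. x \<bullet> v\<close> of the coordinate map.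
\<close>

definition continuous_semimartingale_on ::
    "'w measure \<Rightarrow> (real \<Rightarrow> 'w measure) \<Rightarrow> 'a topology \<Rightarrow> ('a, 'e::real_inner) chart set
      \<Rightarrow> (real \<Rightarrow> 'w \<Rightarrow> 'a) \<Rightarrow> bool" where
  "continuous_semimartingale_on P F M \<A> X \<longleftrightarrow>
     continuous_adapted P F M X \<and>
     (\<forall>(U, \<phi>)\<in>\<A>. \<forall>S T.
        stopping_time F S \<and> stopping_time F T \<and>
        (\<forall>\<omega>\<in>space P. 0 \<le> S \<omega> \<and> S \<omega> \<le> T \<omega> \<and>
           (S \<omega> < T \<omega> \<longrightarrow> (\<forall>t\<in>{S \<omega>..T \<omega>}. X t \<omega> \<in> U))) \<longrightarrow>
        (\<forall>v. real_semimartingale P F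
           (\<lambda>t \<omega>. (\<phi> (X (max (S \<omega>) (min t (T \<omega>))) \<omega>) - \<phi> (X (S \<omega>) \<omega>)) \<bullet> v)))"


section \<open>Bounded perturbations\<close>

definition bounded_perturbation ::
    "('a rchain set \<Rightarrow> real) \<Rightarrow> (real \<Rightarrow> 'a rchain set) \<Rightarrow> (real \<Rightarrow> 'a rchain set) \<Rightarrow> bool" where
  "bounded_perturbation N Y Z \<longleftrightarrow> bdd_above ((\<lambda>t. N (homology_diff (Y t) (Z t))) ` {0..})"

text \<open>
  A statement \<open>\<Phi>\<close> about random paths in \<open>H\<^sub>1(M; \<real>)\<close> which is unchanged if every path is
  subjected to a bounded perturbation.
\<close>

definition unchanged_by_bounded_perturbations ::
    "'w set \<Rightarrow> 'a topology \<Rightarrow> ('a rchain set \<Rightarrow> real)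
      \<Rightarrow> (('w \<Rightarrow> real \<Rightarrow> 'a rchain set) \<Rightarrow> bool) \<Rightarrow> bool" where
  "unchanged_by_bounded_perturbations \<Omega> M N \<Phi> \<longleftrightarrow>
     (\<forall>Y Z. (\<forall>\<omega>\<in>\<Omega>. (\<forall>t\<ge>0. Y \<omega> t \<in> real_homology 1 M \<and> Z \<omega> t \<in> real_homology 1 M) \<and>
                    bounded_perturbation N (Y \<omega>) (Z \<omega>)) \<longrightarrow>
            \<Phi> Y = \<Phi> Z)"

end

theory Submission
  imports Defs
begin

text \<open>
  In \<open>H\<^sub>t - H'\<^sub>t\<close> the trajectory of the process cancels, so only the cycle \<open>[\<sigma>] - [\<sigma>']\<close> formed by two
  closing paths with common end points remains. Cover \<open>M\<close> by finitely many coordinate balls. A path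
  of length at most \<open>L\<close> is cut into a number of pieces that depends only on \<open>L\<close>, each inside one of the
  balls. Join every point to one of finitely many base points by a path inside all the (slightly
  enlarged) balls that contain the point. As the balls are contractible, a piece is then determined
  up to homology by its ball and the base points of its two ends. Hence the cycles \<open>[\<sigma>] - [\<sigma>']\<close>
  represent only finitely many homology classes, and any function of these classes is bounded.
\<close>

section \<open>Chains of paths\<close>

text \<open>Closing paths need not vary continuously with their end points, so compactness of the
  set of end points gives no bound by itself; the length bound has to be turned into a count. For
  this a piece \<tau> from p to q is replaced by the chain \<tau> - e p + e q, where e p runs from p
  to its base point. The boundary of this chain lives on base points, so two pieces with the same
  ball and base points differ by a cycle in a contractible set. Along consecutive pieces the detours
  cancel except at the two ends of the path, and those are shared by \<sigma> and \<sigma>'. Each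
  chart contributes three concentric balls: those of radius r cover \<open>M\<close>, a short piece
  starting in one stays in the closed ball of radius 2r, and the detours stay in the open ball of
  radius 3r. All homologies are found with integer coefficients. Extension of scalars commutes with
  the boundary and carries them to real homology.\<close>

definition path_chain :: "(real \<Rightarrow> 'a) \<Rightarrow> 'a chain" where
  "path_chain g = frag_of (path_simplex g)"

definition point_chain :: "'a \<Rightarrow> 'a chain" where
  "point_chain x = frag_of (restrict (\<lambda>_. x) (standard_simplex 0))"

definition path_segment :: "(real \<Rightarrow> 'a) \<Rightarrow> real \<Rightarrow> real \<Rightarrow> real \<Rightarrow> 'a" where
  "path_segment g a b s = g (a + s * (b - a))"

lemma singular_simplex_path_simplex:
  assumes "pathin X g"
  shows "singular_simplex 1 X (path_simplex g)"
proof -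
  let ?\<Delta> = "subtopology (powertop_real UNIV) (standard_simplex 1)"
  have "continuous_map ?\<Delta> euclideanreal (\<lambda>u. u 1)"
    by (rule continuous_map_from_subtopology[OF continuous_map_product_projection]) simp
  then have "continuous_map ?\<Delta> (top_of_set {0..1}) (\<lambda>u. u 1)"
    by (simp add: continuous_map_in_subtopology standard_simplex_def Pi_iff)
  then have "continuous_map ?\<Delta> X (g \<circ> (\<lambda>u. u 1))"
    using assms unfolding pathin_def by (rule continuous_map_compose)
  then have "continuous_map ?\<Delta> X (path_simplex g)"
    by (rule continuous_map_eq) (simp add: path_simplex_def)
  then show ?thesis
    by (simp add: singular_simplex_def path_simplex_def)
qed

lemma singular_chain_path_chain: "pathin X g \<Longrightarrow> singular_chain 1 X (path_chain g)"
  by (simp add: path_chain_def singular_chain_of singular_simplex_path_simplex del: One_nat_def)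

lemma chain_boundary_path_chain: "chain_boundary 1 (path_chain g) = point_chain (g 1) - point_chain (g 0)"
proof -
  have u: "simplical_face k u \<in> standard_simplex 1" if "u \<in> standard_simplex 0" "k \<le> 1" for k u
    using simplical_face_in_standard_simplex[of 1 k u] that by simp
  have 0: "simplical_face 0 u 1 = 1" "simplical_face 1 u 1 = 0" if "u \<in> standard_simplex 0" for u :: "nat \<Rightarrow> real"
    using that by (simp_all add: simplical_face_def standard_simplex_def)
  have "singular_face 1 0 (path_simplex g) = restrict (\<lambda>_. g 1) (standard_simplex 0)"
    using u[of _ 0] 0(1) by (simp add: singular_face_def path_simplex_def restrict_def fun_eq_iff del: One_nat_def)
  moreover have "singular_face 1 1 (path_simplex g) = restrict (\<lambda>_. g 0) (standard_simplex 0)"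
    using u[of _ 1] 0(2) by (simp add: singular_face_def path_simplex_def restrict_def fun_eq_iff del: One_nat_def)
  ultimately show ?thesis
    by (simp add: path_chain_def point_chain_def chain_boundary_of frag_cmul_minus_one)
qed

lemma pathin_path_segment:
  assumes "pathin X g" "a \<in> {0..1}" "b \<in> {0..1}"
  shows "pathin X (path_segment g a b)"
proof -
  have "a + s * (b - a) \<in> {0..1}" if "s \<in> {0..1}" for s
  proof -
    have "a + s * (b - a) = (1 - s) * a + s * b" by (simp add: algebra_simps)
    then show ?thesis
      using that assms(2,3) convex_bound_le[of a 1 b "1-s" s] by auto
  qed
  moreover have "continuous_on {0..1} (\<lambda>s. a + s * (b - a))"
    by (intro continuous_intros)
  ultimately have "continuous_map (top_of_set {0..1}) (top_of_set {0..1}) (\<lambda>s. a + s * (b - a))"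
    by (simp add: Pi_iff)
  then have "continuous_map (top_of_set {0..1}) X (g \<circ> (\<lambda>s. a + s * (b - a)))"
    using assms(1) unfolding pathin_def by (rule continuous_map_compose)
  then show ?thesis
    by (simp add: pathin_def path_segment_def[abs_def] comp_def)
qed

text \<open>In degree 1 reduced and ordinary homology agree, so the homology group of a contractible
  space is trivial. Reading this in the carrier, whose elements are cosets of boundaries, turns it
  into a statement about chains.\<close>

lemma singular_relboundary_contractible:
  assumes "contractible_space X" and c: "singular_relcycle 1 X {} c"
  shows "singular_relboundary 1 X {} c"
proof -
  have "trivial_group (homology_group 1 X)"
    using trivial_reduced_homology_group_contractible_space[OF assms(1), of 1]
    by (simp add: un_reduced_homology_group)
  then have triv: "carrier (homology_group (int 1) X) = {singular_relboundary_set 1 X {}}"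
    unfolding one_relative_homology_group[symmetric] trivial_group_def by simp
  have "homologous_rel_set 1 X {} c \<in> carrier (homology_group (int 1) X)"
    unfolding carrier_relative_homology_group using c by blast
  then have "homologous_rel_set 1 X {} c = singular_relboundary_set 1 X {}"
    unfolding triv by blast
  then show ?thesis
    by (simp only: homologous_rel_set_eq_relboundary)
qed

lemma singular_relboundary_contractible_subtopology:
  assumes "contractible_space (subtopology X S)" and "singular_relcycle 1 (subtopology X S) {} c"
  shows "singular_relboundary 1 X {} c"
  using singular_boundary_mono[OF subset_UNIV singular_relboundary_contractible[OF assms]] by simp

text \<open>The chain is the image under \<open>g\<close> of the same combination of segments of the
  identity path. In the interval that combination is a cycle, and the interval is contractible. The
  three parameters may come in any order and may coincide.\<close>

lemma path_chain_subdivide: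
  assumes g: "pathin X g" and "a \<in> {0..1}" "b \<in> {0..1}" "c \<in> {0..1}"
  shows "singular_relboundary 1 X {} 
     (path_chain (path_segment g a b) + path_chain (path_segment g b c) - path_chain (path_segment g a c))"
proof -
  let ?I = "top_of_set {0..1::real}"
  have idp: "pathin ?I id" by (simp add: pathin_def)
  have sc: "singular_chain 1 ?I (path_chain (path_segment id u v))" if "u \<in> {0..1}" "v \<in> {0..1}" for u v :: real
    using singular_chain_path_chain pathin_path_segment[OF idp that] by blast
  let ?c = "path_chain (path_segment id a b) + path_chain (path_segment id b c) - path_chain (path_segment id a c)"
  have "singular_relcycle 1 ?I {} ?c"
    unfolding singular_cycle
    using sc assms(2-4)
    by (simp add: singular_chain_add singular_chain_diff chain_boundary_add chain_boundary_diff 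
        chain_boundary_path_chain path_segment_def del: One_nat_def)
  moreover have "contractible_space ?I"
    by (simp add: convex_imp_contractible)
  ultimately have "singular_relboundary 1 ?I {} ?c"
    by (rule singular_relboundary_contractible[rotated])
  then have "singular_relboundary 1 X {} (chain_map 1 g ?c)"
    using g unfolding pathin_def by (rule singular_relboundary_chain_map) auto
  moreover have "simplex_map 1 g (path_simplex (path_segment id u v)) = path_simplex (path_segment g u v)" for u v
    by (auto simp: simplex_map_def path_simplex_def path_segment_def fun_eq_iff)
  then have "chain_map 1 g (path_chain (path_segment id u v)) = path_chain (path_segment g u v)" for u v
    by (simp add: path_chain_def)
  ultimately show ?thesis
    by (simp add: chain_map_add chain_map_diff)
qed

section \<open>Passage to real coefficients\<close>

definition real_chain :: "'a chain \<Rightarrow> 'a rchain" where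
  "real_chain c = Poly_Mapping.map real_of_int c"

lemma lookup_real_chain: "Poly_Mapping.lookup (real_chain c) f = real_of_int (Poly_Mapping.lookup c f)"
  by (simp add: real_chain_def map.rep_eq when_def)

lemma keys_real_chain: "Poly_Mapping.keys (real_chain c) = Poly_Mapping.keys c"
  by (simp add: keys_def lookup_real_chain set_eq_iff in_keys_iff)

lemma real_chain_0 [simp]: "real_chain 0 = 0"
  by (rule poly_mapping_eqI) (simp add: lookup_real_chain)

lemma real_chain_add: "real_chain (a + b) = real_chain a + real_chain b"
  by (rule poly_mapping_eqI) (simp add: lookup_real_chain lookup_add)

lemma real_chain_diff: "real_chain (a - b) = real_chain a - real_chain b"
  by (rule poly_mapping_eqI) (simp add: lookup_real_chain lookup_minus)

lemma real_chain_frag_of: "real_chain (frag_of f) = Poly_Mapping.single f 1"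
  by (rule poly_mapping_eqI) (simp add: lookup_real_chain lookup_single when_def)

lemma real_chain_frag_cmul_frag_of:
  "real_chain (frag_cmul k (frag_of f)) = Poly_Mapping.single f (real_of_int k)"
  by (rule poly_mapping_eqI) (simp add: lookup_real_chain lookup_single when_def)

lemma real_chain_sum: "real_chain (\<Sum>i\<in>I. c i) = (\<Sum>i\<in>I. real_chain (c i))"
  by (induction I rule: infinite_finite_induct) (simp_all add: real_chain_add)

text \<open>The freedom to sum over any finite set containing the support lets chains with different
  supports be added term by term.\<close>

lemma real_boundary_eq_sum:
  assumes "finite S" "Poly_Mapping.keys c \<subseteq> S" "p \<noteq> 0"
  shows "real_boundary p c = (\<Sum>f\<in>S. \<Sum>k\<le>p.
           Poly_Mapping.single (singular_face p k f) ((-1) ^ k * Poly_Mapping.lookup c f))"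
  unfolding real_boundary_def using assms
  by (simp, intro sum.mono_neutral_left) (auto simp: in_keys_iff)

lemma real_boundary_add: "real_boundary p (a + b) = real_boundary p a + real_boundary p b"
proof (cases "p = 0")
  case False
  let ?S = "Poly_Mapping.keys a \<union> Poly_Mapping.keys b"
  have "finite ?S" "Poly_Mapping.keys (a + b) \<subseteq> ?S" "Poly_Mapping.keys a \<subseteq> ?S" "Poly_Mapping.keys b \<subseteq> ?S"
    using keys_add[of a b] by auto
  with False show ?thesis
    by (simp add: real_boundary_eq_sum[of ?S] lookup_add distrib_left single_add sum.distrib)
qed (simp add: real_boundary_def)

lemma real_boundary_0 [simp]: "real_boundary p 0 = 0"
  by (simp add: real_boundary_def)

lemma real_boundary_diff: "real_boundary p (a - b) = real_boundary p a - real_boundary p b"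
  by (metis real_boundary_add add_diff_cancel_right' diff_add_cancel)

text \<open>Both sides are additive in \<open>c\<close>, so a single simplex decides. This is what
  turns integral boundaries into real ones.\<close>

lemma real_boundary_real_chain: "real_boundary p (real_chain c) = real_chain (chain_boundary p c)"
proof (cases "p = 0")
  case False
  show ?thesis
    using subset_UNIV
  proof (induction c rule: frag_induction)
    case (one f)
    then show ?case
      using False
      by (simp add: real_chain_frag_of chain_boundary_of real_chain_sum real_chain_frag_cmul_frag_of)
         (simp add: real_boundary_def)
  qed (simp_all add: real_chain_diff real_boundary_diff chain_boundary_diff)
qed (simp add: real_boundary_def chain_boundary_def)

lemma real_chain_in_real_boundaries:
  assumes "singular_relboundary p X {} c"
  shows "real_chain c \<in> real_boundaries p X"
proof -
  obtain d where d: "singular_chain (Suc p) X d" "chain_boundary (Suc p) d = c"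
    using assms by (auto simp: singular_boundary)
  have "real_chain d \<in> real_chains (Suc p) X"
    using d(1) by (simp add: real_chains_def keys_real_chain singular_chain_def)
  then show ?thesis
    using real_boundary_real_chain[of "Suc p" d] d(2) unfolding real_boundaries_def by (metis image_eqI)
qed

section \<open>Boundaries as a subgroup, and arithmetic of cosets\<close>

lemma real_boundaries_0: "0 \<in> real_boundaries p X"
  unfolding real_boundaries_def by (rule image_eqI[of _ _ 0]) (auto simp: real_chains_def)

lemma real_boundaries_diff:
  assumes "a \<in> real_boundaries p X" "b \<in> real_boundaries p X"
  shows "a - b \<in> real_boundaries p X"
proof -
  obtain c d where cd: "c \<in> real_chains (Suc p) X" "d \<in> real_chains (Suc p) X"
      "a = real_boundary (Suc p) c" "b = real_boundary (Suc p) d"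
    using assms by (auto simp: real_boundaries_def)
  have "c - d \<in> real_chains (Suc p) X"
    using cd(1,2) keys_diff[of c d] by (auto simp: real_chains_def)
  then show ?thesis
    unfolding real_boundaries_def cd(3,4) real_boundary_diff[symmetric] by (rule imageI)
qed

lemma real_boundaries_add:
  assumes "a \<in> real_boundaries p X" "b \<in> real_boundaries p X"
  shows "a + b \<in> real_boundaries p X"
  using real_boundaries_diff[OF assms(1) real_boundaries_diff[OF real_boundaries_0 assms(2)]] by simp

lemma homology_class_eqI:
  assumes "a - b \<in> real_boundaries p X"
  shows "homology_class p X a = homology_class p X b"
proof -
  have "homology_class p X u \<subseteq> homology_class p X v" if "u - v \<in> real_boundaries p X" for u v :: "'a rchain"
  proof
    fix w assume "w \<in> homology_class p X u"
    then obtain c where c: "c \<in> real_boundaries p X" "w = u + c"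
      by (auto simp: homology_class_def)
    then have "w = v + ((u - v) + c)" "(u - v) + c \<in> real_boundaries p X"
      using that by (simp_all add: real_boundaries_add)
    then show "w \<in> homology_class p X v"
      unfolding homology_class_def by blast
  qed
  moreover have "b - a \<in> real_boundaries p X"
    using real_boundaries_diff[OF real_boundaries_0 assms] by simp
  ultimately show ?thesis
    using assms by blast
qed

lemma homology_diff_class:
  "homology_diff (homology_class p X a) (homology_class p X b) = homology_class p X (a - b)"
proof
  show "homology_diff (homology_class p X a) (homology_class p X b) \<subseteq> homology_class p X (a - b)"
  proof
    fix w assume "w \<in> homology_diff (homology_class p X a) (homology_class p X b)"
    then obtain c d where "c \<in> real_boundaries p X" "d \<in> real_boundaries p X" "w = (a + c) - (b + d)"
      by (auto simp: homology_diff_def homology_class_def)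
    then have "w = (a - b) + (c - d)" "c - d \<in> real_boundaries p X"
      by (simp_all add: real_boundaries_diff)
    then show "w \<in> homology_class p X (a - b)"
      unfolding homology_class_def by blast
  qed
next
  show "homology_class p X (a - b) \<subseteq> homology_diff (homology_class p X a) (homology_class p X b)"
  proof
    fix w assume "w \<in> homology_class p X (a - b)"
    then obtain c where c: "c \<in> real_boundaries p X" "w = (a + c) - (b + 0)"
      by (auto simp: homology_class_def)
    then show "w \<in> homology_diff (homology_class p X a) (homology_class p X b)"
      unfolding homology_diff_def homology_class_def using real_boundaries_0 by blast
  qed
qed

lemma homology_zero_in_real_homology: "homology_zero p X \<in> real_homology p X"
  unfolding homology_zero_def real_homology_def
  by (rule imageI) (simp add: real_cycles_def real_chains_def)

section \<open>Subdivided paths\<close>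

text \<open>
  The intersection of two of the sets \<open>U j\<close> may have infinitely many components, so the connecting
  paths have to respect all \<open>j\<close> at once.
\<close>

lemma finite_net_of_paths:
  assumes "compact_space M" "locally_path_connected_space M" "finite J"
    and A: "\<And>j. j \<in> J \<Longrightarrow> closedin M (A j)"
    and U: "\<And>j. j \<in> J \<Longrightarrow> openin M (U j)"
    and AU: "\<And>j. j \<in> J \<Longrightarrow> A j \<subseteq> U j"
  obtains Q e where "finite Q"
    and "\<And>p. p \<in> topspace M \<Longrightarrow> pathin M (e p) \<and> e p 0 = p \<and> e p 1 \<in> Q"
    and "\<And>p j. j \<in> J \<Longrightarrow> p \<in> A j \<Longrightarrow> e p ` {0..1} \<subseteq> U j"
proof -
  \<comment> \<open>A nice neighbourhood of \<open>p\<close> avoids every \<open>A j\<close> that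
    does not contain \<open>p\<close>. Hence a point of \<open>W\<close> in \<open>A j\<close>
    forces \<open>p\<close> into \<open>A j\<close>, and then all of \<open>W\<close> lies in
    \<open>U j\<close>. This is what keeps a path inside \<open>W\<close> from any of its points to
    \<open>p\<close> within all the required sets at once.\<close>
  define nice where "nice p W \<longleftrightarrow> openin M W \<and> path_connectedin M W \<and> p \<in> W \<and>
      (\<forall>j\<in>J. (p \<in> A j \<longrightarrow> W \<subseteq> U j) \<and> (p \<notin> A j \<longrightarrow> W \<inter> A j = {}))" for p W
  have "\<exists>W. nice p W" if p: "p \<in> topspace M" for p
  proof -
    \<comment> \<open>The factor \<open>topspace M\<close> keeps this set open in \<open>M\<close>
      also for empty \<open>J\<close>.\<close>
    let ?G = "(\<Inter>j\<in>J. if p \<in> A j then U j else topspace M - A j) \<inter> topspace M"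
    have "openin M ?G"
      using \<open>finite J\<close> U A by (intro openin_INT) auto
    moreover have "p \<in> ?G"
      using p AU by auto
    ultimately obtain W where W: "openin M W" "path_connectedin M W" "p \<in> W" "W \<subseteq> ?G"
      using \<open>locally_path_connected_space M\<close> unfolding locally_path_connected_space by meson
    have "(p \<in> A j \<longrightarrow> W \<subseteq> U j) \<and> (p \<notin> A j \<longrightarrow> W \<inter> A j = {})" if "j \<in> J" for j
    proof -
      have "W \<subseteq> (if p \<in> A j then U j else topspace M - A j)"
        using W(4) that by blast
      then show ?thesis by (auto split: if_splits)
    qed
    with W show ?thesis unfolding nice_def by blast
  qed
  then obtain W where W: "\<And>p. p \<in> topspace M \<Longrightarrow> nice p (W p)"
    by metis
  have "\<And>V. V \<in> W ` topspace M \<Longrightarrow> openin M V" "topspace M \<subseteq> \<Union>(W ` topspace M)"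
    using W unfolding nice_def by blast+
  then obtain \<F> where "finite \<F>" "\<F> \<subseteq> W ` topspace M" "topspace M \<subseteq> \<Union>\<F>"
    using compactinD[OF \<open>compact_space M\<close>[unfolded compact_space_def]] by meson
  then obtain Q where Q: "finite Q" "Q \<subseteq> topspace M" "topspace M \<subseteq> \<Union>(W ` Q)"
    using finite_subset_image[of \<F> W "topspace M"] by blast
  have "\<exists>g. pathin M g \<and> g 0 = p \<and> g 1 \<in> Q \<and> (\<forall>j\<in>J. p \<in> A j \<longrightarrow> g ` {0..1} \<subseteq> U j)"
    if p: "p \<in> topspace M" for p
  proof -
    obtain q where q: "q \<in> Q" "p \<in> W q" using Q(3) p by blast
    then have nq: "nice q (W q)" using Q(2) W by blast
    then obtain g where g: "pathin M g" "g ` {0..1} \<subseteq> W q" "g 0 = p" "g 1 = q"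
      using q(2) unfolding nice_def path_connectedin image_subset_iff_funcset by blast
    have "W q \<subseteq> U j" if "j \<in> J" "p \<in> A j" for j
      using nq that q(2) unfolding nice_def by blast
    with g q(1) show ?thesis by blast
  qed
  then obtain e where "\<And>p. p \<in> topspace M \<Longrightarrow> pathin M (e p) \<and> e p 0 = p \<and> e p 1 \<in> Q
      \<and> (\<forall>j\<in>J. p \<in> A j \<longrightarrow> e p ` {0..1} \<subseteq> U j)"
    by metis
  moreover have "p \<in> topspace M" if "j \<in> J" "p \<in> A j" for p j
    using closedin_subset[OF A[OF that(1)]] that(2) by blast
  ultimately show ?thesis
    using that[OF Q(1), of e] by blast
qed

text \<open>Each of the two chains has as boundary the difference of the base points reached from
  the ends of its path. These base points agree, so the difference of the chains is a cycle, and all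
  the paths involved lie in the contractible set \<open>U\<close>.\<close>

lemma path_chains_in_contractible:
  assumes con: "contractible_space (subtopology M U)" and j: "pathin M \<tau>" "\<tau> ` {0..1} \<subseteq> U" "pathin M \<tau>'" "\<tau>' ` {0..1} \<subseteq> U"
    and e: "\<And>p. p \<in> {\<tau> 0, \<tau> 1, \<tau>' 0, \<tau>' 1} \<Longrightarrow> pathin M (e p) \<and> e p 0 = p \<and> e p ` {0..1} \<subseteq> U"
    and ends: "e (\<tau> 0) 1 = e (\<tau>' 0) 1" "e (\<tau> 1) 1 = e (\<tau>' 1) 1"
  shows "homologous_rel 1 M {} (path_chain \<tau> - path_chain (e (\<tau> 0)) + path_chain (e (\<tau> 1)))
           (path_chain \<tau>' - path_chain (e (\<tau>' 0)) + path_chain (e (\<tau>' 1)))"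
proof -
  let ?N = "subtopology M U"
  let ?c = "(path_chain \<tau> - path_chain (e (\<tau> 0)) + path_chain (e (\<tau> 1))) -
            (path_chain \<tau>' - path_chain (e (\<tau>' 0)) + path_chain (e (\<tau>' 1)))"
  have sc: "singular_chain 1 ?N (path_chain g)" if "pathin M g" "g ` {0..1} \<subseteq> U" for g
    using that by (intro singular_chain_path_chain) (auto simp: pathin_subtopology)
  have "singular_chain 1 ?N ?c"
    using sc j e by (intro singular_chain_diff singular_chain_add) auto
  moreover have "chain_boundary 1 ?c = 0"
    using e ends by (simp add: chain_boundary_add chain_boundary_diff chain_boundary_path_chain del: One_nat_def)
  ultimately have "singular_relcycle 1 ?N {} ?c"
    by (simp add: singular_cycle del: One_nat_def)
  then show ?thesis
    unfolding homologous_rel_def by (rule singular_relboundary_contractible_subtopology[OF con])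
qed

section \<open>Finiteness for paths cut into a fixed number of pieces\<close>

primrec multiple_sums :: "'c::monoid_add set \<Rightarrow> nat \<Rightarrow> 'c set" where
  "multiple_sums E 0 = {0}"
| "multiple_sums E (Suc n) = (\<lambda>(c, f). c + f) ` (multiple_sums E n \<times> E)"

lemma finite_multiple_sums: "finite E \<Longrightarrow> finite (multiple_sums E n)"
  by (induction n) auto

text \<open>Division points may repeat, so a path that needs fewer pieces also counts as cut into
  exactly \<open>n\<close>.\<close>

definition subdivided_path :: "(real \<Rightarrow> 'a) \<Rightarrow> 'a set set \<Rightarrow> nat \<Rightarrow> bool" where
  "subdivided_path \<sigma> \<C> n \<longleftrightarrow> (\<exists>t :: nat \<Rightarrow> real. t 0 = 0 \<and> t n = 1 \<and>
     (\<forall>k<n. t k \<le> t (Suc k) \<and> (\<exists>S\<in>\<C>. \<sigma> ` {t k..t (Suc k)} \<subseteq> S)))"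

text \<open>A piece corrected by its detours is homologous to one of at most |J| |Q|^2 fixed chains,
  and the corrected path is homologous to the sum over its pieces. So only the \<open>n\<close>-fold
  sums of these chains occur, and the set \<open>C\<close> consists of the differences of two such
  sums.\<close>

lemma finitely_many_classes_of_subdivided_paths:
  assumes M: "compact_space M" "locally_path_connected_space M" "finite J"
    and A: "\<And>j. j \<in> J \<Longrightarrow> closedin M (A j)"
    and U: "\<And>j. j \<in> J \<Longrightarrow> openin M (U j)"
    and AU: "\<And>j. j \<in> J \<Longrightarrow> A j \<subseteq> U j"
    and con: "\<And>j. j \<in> J \<Longrightarrow> contractible_space (subtopology M (U j))"
  obtains C where "finite C"
    and "\<And>\<sigma> \<sigma>'. pathin M \<sigma> \<Longrightarrow> pathin M \<sigma>' \<Longrightarrow> \<sigma> 0 = \<sigma>' 0 \<Longrightarrow> \<sigma> 1 = \<sigma>' 1 \<Longrightarrow>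
           subdivided_path \<sigma> (A ` J) n \<Longrightarrow> subdivided_path \<sigma>' (A ` J) n \<Longrightarrow>
           \<exists>c\<in>C. homologous_rel 1 M {} (path_chain \<sigma> - path_chain \<sigma>') c"
proof -
  obtain Q e where Q: "finite Q"
    and e: "\<And>p. p \<in> topspace M \<Longrightarrow> pathin M (e p) \<and> e p 0 = p \<and> e p 1 \<in> Q"
    and eU: "\<And>p j. j \<in> J \<Longrightarrow> p \<in> A j \<Longrightarrow> e p ` {0..1} \<subseteq> U j"
    using finite_net_of_paths[where A = A and U = U, OF M A U AU] by blast
  define corr where "corr \<tau> = path_chain \<tau> - path_chain (e (\<tau> 0)) + path_chain (e (\<tau> 1))" for \<tau> :: "real \<Rightarrow> 'a"
  define small where "small j a b \<tau> \<longleftrightarrow> pathin M \<tau> \<and> \<tau> ` {0..1} \<subseteq> A j \<and> e (\<tau> 0) 1 = a \<and> e (\<tau> 1) 1 = b"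
    for j a b \<tau>
  \<comment> \<open>One representative is chosen for each ball and pair of base points. A triple
    admitting no such path contributes an arbitrary chain, which merely enlarges the finite
    set.\<close>
  define E where "E = (\<lambda>(j, a, b). corr (SOME \<tau>. small j a b \<tau>)) ` (J \<times> Q \<times> Q)"
  have "finite E"
    using M(3) Q by (simp add: E_def)
  have E: "\<exists>f\<in>E. homologous_rel 1 M {} (corr \<tau>) f" if \<tau>: "pathin M \<tau>" "j \<in> J" "\<tau> ` {0..1} \<subseteq> A j" for \<tau> j
  proof -
    let ?a = "e (\<tau> 0) 1" and ?b = "e (\<tau> 1) 1"
    define \<tau>' where "\<tau>' = (SOME \<tau>. small j ?a ?b \<tau>)"
    have "small j ?a ?b \<tau>"
      using \<tau> by (simp add: small_def)
    then have \<tau>': "small j ?a ?b \<tau>'"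
      unfolding \<tau>'_def by (rule someI[of "small j ?a ?b"])
    have mem: "{\<tau> 0, \<tau> 1, \<tau>' 0, \<tau>' 1} \<subseteq> A j"
      using \<tau>(3) \<tau>' unfolding small_def by auto
    have "homologous_rel 1 M {} (corr \<tau>) (corr \<tau>')"
      unfolding corr_def
    proof (rule path_chains_in_contractible[OF con[OF \<tau>(2)]])
      show "pathin M (e p) \<and> e p 0 = p \<and> e p ` {0..1} \<subseteq> U j" if "p \<in> {\<tau> 0, \<tau> 1, \<tau>' 0, \<tau>' 1}" for p
      proof -
        have "p \<in> A j"
          using that mem by blast
        moreover from this have "p \<in> topspace M"
          using closedin_subset[OF A[OF \<tau>(2)]] by blast
        ultimately show ?thesis
          using e[of p] eU[OF \<tau>(2), of p] by simp
      qed
    qed (use \<tau> \<tau>' AU[OF \<tau>(2)] in \<open>auto simp: small_def\<close>)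
    moreover have "\<tau> 0 \<in> topspace M" "\<tau> 1 \<in> topspace M"
      using mem closedin_subset[OF A[OF \<tau>(2)]] by auto
    then have "corr \<tau>' \<in> E"
      unfolding E_def \<tau>'_def using e \<tau>(2) by (intro image_eqI[of _ _ "(j, ?a, ?b)"]) auto
    ultimately show ?thesis by blast
  qed
  have sub: "\<exists>c\<in>multiple_sums E n. homologous_rel 1 M {} (corr \<sigma>) c"
    if \<sigma>: "pathin M \<sigma>" "subdivided_path \<sigma> (A ` J) n" for \<sigma>
  proof -
    obtain t :: "nat \<Rightarrow> real" where t: "t 0 = 0" "t n = 1"
      and step: "\<forall>k<n. t k \<le> t (Suc k) \<and> (\<exists>S\<in>A ` J. \<sigma> ` {t k..t (Suc k)} \<subseteq> S)"
      using \<sigma>(2) unfolding subdivided_path_def by (elim exE conjE)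
    have tstep: "t k \<le> t (Suc k)" "\<exists>j\<in>J. \<sigma> ` {t k..t (Suc k)} \<subseteq> A j" if "k < n" for k
      using step that by blast+
    have mono: "t k \<le> t l" if "k \<le> l" "l \<le> n" for k l
      using that
    proof (induction l rule: dec_induct)
      case (step m)
      then have "t k \<le> t m" "t m \<le> t (Suc m)"
        using tstep(1)[of m] by auto
      then show ?case by (rule order_trans)
    qed simp
    have t01: "t k \<in> {0..1}" if "k \<le> n" for k
      using mono[of 0 k] mono[of k n] t that by auto
    have seg: "pathin M (path_segment \<sigma> u v)" if "u \<in> {0..1}" "v \<in> {0..1}" for u v
      using pathin_path_segment[OF \<sigma>(1) that] .
    have "\<exists>c\<in>multiple_sums E k. homologous_rel 1 M {} (corr (path_segment \<sigma> 0 (t k))) c" if "k \<le> n" for k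
      using that
    proof (induction k)
      case 0
      \<comment> \<open>With three equal division points the relation reads p + p - p, so a constant
        path is a boundary. Its two detours cancel inside \<open>corr\<close>.\<close>
      have "singular_relboundary 1 M {} (path_chain (path_segment \<sigma> 0 0))"
        using path_chain_subdivide[OF \<sigma>(1), of 0 0 0] by simp
      then show ?case
        by (simp add: corr_def homologous_rel_def t path_segment_def[abs_def])
    next
      case (Suc k)
      then obtain c where c: "c \<in> multiple_sums E k" "homologous_rel 1 M {} (corr (path_segment \<sigma> 0 (t k))) c"
        by auto
      obtain j where j: "j \<in> J" "\<sigma> ` {t k..t (Suc k)} \<subseteq> A j"
        using tstep(2)[of k] Suc.prems by auto
      let ?\<tau> = "path_segment \<sigma> (t k) (t (Suc k))"
      have tk: "t k \<in> {0..1}" "t (Suc k) \<in> {0..1}" "t k \<le> t (Suc k)"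
        using t01 tstep(1) Suc.prems by auto
      have "t k + s * (t (Suc k) - t k) \<in> {t k..t (Suc k)}" if "s \<in> {0..1}" for s
        using that tk(3) mult_left_le_one_le[of "t (Suc k) - t k" s] by (auto simp: mult.commute)
      then have "?\<tau> ` {0..1} \<subseteq> A j"
        using j(2) unfolding path_segment_def by blast
      with E[OF seg[OF tk(1,2)] j(1)] obtain f where f: "f \<in> E" "homologous_rel 1 M {} (corr ?\<tau>) f"
        by blast
      have "homologous_rel 1 M {} (corr (path_segment \<sigma> 0 (t k)) + corr ?\<tau>) (corr (path_segment \<sigma> 0 (t (Suc k))))"
      proof -
        \<comment> \<open>The detours at the common point \<open>\<sigma> (t k)\<close> cancel, and
          those at the outer ends are the same on both sides.\<close>
        have "corr (path_segment \<sigma> 0 (t k)) + corr ?\<tau> - corr (path_segment \<sigma> 0 (t (Suc k)))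
          = path_chain (path_segment \<sigma> 0 (t k)) + path_chain ?\<tau> - path_chain (path_segment \<sigma> 0 (t (Suc k)))"
          by (simp add: corr_def path_segment_def)
        then show ?thesis
          using path_chain_subdivide[OF \<sigma>(1) _ tk(1,2), of 0] by (simp add: homologous_rel_def)
      qed
      then have "homologous_rel 1 M {} (corr (path_segment \<sigma> 0 (t (Suc k)))) (c + f)"
        using homologous_rel_add[OF c(2) f(2)] homologous_rel_sym homologous_rel_trans by blast
      moreover have "c + f \<in> multiple_sums E (Suc k)"
        using c(1) f(1) by force
      ultimately show ?case by blast
    qed
    from this[of n] show ?thesis
      by (simp add: t path_segment_def[abs_def])
  qed
  let ?C = "(\<lambda>(c, d). c - d) ` (multiple_sums E n \<times> multiple_sums E n)"
  show ?thesis
  proof (rule that[of ?C])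
    show "finite ?C"
      using finite_multiple_sums[OF \<open>finite E\<close>] by auto
    fix \<sigma> \<sigma>' assume *: "pathin M \<sigma>" "pathin M \<sigma>'" "\<sigma> 0 = \<sigma>' 0" "\<sigma> 1 = \<sigma>' 1"
      "subdivided_path \<sigma> (A ` J) n" "subdivided_path \<sigma>' (A ` J) n"
    obtain c d where "c \<in> multiple_sums E n" "d \<in> multiple_sums E n"
      and cd: "homologous_rel 1 M {} (corr \<sigma>) c" "homologous_rel 1 M {} (corr \<sigma>') d"
      using sub * by meson
    moreover have "corr \<sigma> - corr \<sigma>' = path_chain \<sigma> - path_chain \<sigma>'"
      using *(3,4) by (simp add: corr_def)
    ultimately show "\<exists>c\<in>?C. homologous_rel 1 M {} (path_chain \<sigma> - path_chain \<sigma>') c"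
      using homologous_rel_diff[OF cd] by force
  qed
qed

section \<open>Finite-dimensional inner product spaces\<close>

text \<open>
  The model space is not of class \<open>euclidean_space\<close>, so the compactness of its balls has to be derived
  from the finite spanning set. In the expansion below \<open>C\<close> may contain \<open>0\<close>, whose term vanishes.
\<close>

lemma orthogonal_expansion:
  fixes B :: "'e::real_inner set"
  assumes "finite B" "span B = UNIV"
  obtains C :: "'e set" where "finite C" "\<And>v. v = (\<Sum>c\<in>C. (v \<bullet> c / (c \<bullet> c)) *\<^sub>R c)"
proof -
  obtain C :: "'e set" where C: "finite C" "span C = UNIV" "pairwise orthogonal C"
    using basis_orthogonal[OF assms(1)] assms(2) by metis
  have "v = (\<Sum>c\<in>C. (v \<bullet> c / (c \<bullet> c)) *\<^sub>R c)" for v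
  proof -
    define w where "w = v - (\<Sum>c\<in>C. (v \<bullet> c / (c \<bullet> c)) *\<^sub>R c)"
    have orth: "d \<bullet> w = 0" if "d \<in> C" for d
    proof -
      have "(\<Sum>c\<in>C. (v \<bullet> c / (c \<bullet> c)) *\<^sub>R c) \<bullet> d = (\<Sum>c\<in>C. if c = d then v \<bullet> d else 0)"
        unfolding inner_sum_left
        using C(3) that by (intro sum.cong) (auto simp: pairwise_def orthogonal_def)
      then show ?thesis
        using C(1) that by (simp add: w_def inner_diff_left inner_commute[of d])
    qed
    have "x \<bullet> w = 0" if "x \<in> span C" for x
      using that by (induction rule: span_induct_alt) (simp_all add: inner_add_left orth)
    then have "w = 0"
      using C(2) by (metis UNIV_I inner_eq_zero_iff)
    then show ?thesis by (simp add: w_def)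
  qed
  with C(1) show ?thesis using that by blast
qed

text \<open>This set is the Minkowski sum of the segments spanned by the vectors \<open>c\<close>,
  and a sum of two compact sets is compact.\<close>

lemma compact_bounded_combinations:
  fixes C :: "'e::real_normed_vector set"
  assumes "finite C"
  shows "compact {\<Sum>c\<in>C. f c *\<^sub>R c | f. \<forall>c\<in>C. \<bar>f c\<bar> \<le> K c}"
  using assms
proof induction
  case (insert a C)
  let ?P = "\<lambda>D f. \<forall>c\<in>D. \<bar>f c\<bar> \<le> K c"
  have "compact ((\<lambda>r. r *\<^sub>R a) ` {- K a..K a})"
    by (intro compact_continuous_image continuous_intros) simp
  then have "compact {x + y | x y. x \<in> (\<lambda>r. r *\<^sub>R a) ` {- K a..K a} \<and> y \<in> {\<Sum>c\<in>C. f c *\<^sub>R c | f. ?P C f}}"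
    using insert.IH by (rule compact_sums)
  also have "{x + y | x y. x \<in> (\<lambda>r. r *\<^sub>R a) ` {- K a..K a} \<and> y \<in> {\<Sum>c\<in>C. f c *\<^sub>R c | f. ?P C f}}
    = {\<Sum>c\<in>insert a C. f c *\<^sub>R c | f. ?P (insert a C) f}" (is "?L = ?R")
  proof
    show "?L \<subseteq> ?R"
    proof clarify
      fix r f assume r: "r \<in> {- K a..K a}" and f: "?P C f"
      let ?f = "f(a := r)"
      have "r *\<^sub>R a + (\<Sum>c\<in>C. f c *\<^sub>R c) = (\<Sum>c\<in>insert a C. ?f c *\<^sub>R c)"
      proof -
        have "(\<Sum>c\<in>C. f c *\<^sub>R c) = (\<Sum>c\<in>C. ?f c *\<^sub>R c)"
          using insert.hyps by (intro sum.cong) auto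
        then show ?thesis using insert.hyps by simp
      qed
      moreover have "?P (insert a C) ?f" using r f by auto
      ultimately show "\<exists>h. r *\<^sub>R a + (\<Sum>c\<in>C. f c *\<^sub>R c) = (\<Sum>c\<in>insert a C. h c *\<^sub>R c) \<and> ?P (insert a C) h"
        by (intro exI[of _ ?f] conjI)
    qed
    show "?R \<subseteq> ?L"
    proof clarify
      fix f assume f: "?P (insert a C) f"
      then have "f a *\<^sub>R a \<in> (\<lambda>r. r *\<^sub>R a) ` {- K a..K a}" "?P C f"
        by (auto simp: abs_le_iff)
      moreover have "(\<Sum>c\<in>insert a C. f c *\<^sub>R c) = f a *\<^sub>R a + (\<Sum>c\<in>C. f c *\<^sub>R c)"
        using insert.hyps by simp
      ultimately show "\<exists>x y. (\<Sum>c\<in>insert a C. f c *\<^sub>R c) = x + y \<and>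
          x \<in> (\<lambda>r. r *\<^sub>R a) ` {- K a..K a} \<and> y \<in> {\<Sum>c\<in>C. f c *\<^sub>R c | f. ?P C f}"
        by blast
    qed
  qed
  finally show ?case .
qed simp

text \<open>By Cauchy-Schwarz the coefficients of the orthogonal expansion are bounded on a ball
  around 0, which is therefore a closed part of a compact set of combinations. Translation gives the
  other centres.\<close>

lemma compact_cball_finite_span:
  fixes B :: "'e::real_inner set"
  assumes "finite B" "span B = UNIV"
  shows "compact (cball (x :: 'e) r)"
proof -
  obtain C :: "'e set" where C: "finite C" "\<And>v. v = (\<Sum>c\<in>C. (v \<bullet> c / (c \<bullet> c)) *\<^sub>R c)"
    using orthogonal_expansion[OF assms] by metis
  \<comment> \<open>For \<open>c = 0\<close> both the coefficient and its bound are 0, since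
    division by zero yields 0.\<close>
  let ?K = "{\<Sum>c\<in>C. f c *\<^sub>R c | f. \<forall>c\<in>C. \<bar>f c\<bar> \<le> r * norm c / (c \<bullet> c)}"
  have "cball 0 r \<subseteq> ?K"
  proof
    fix v :: 'e assume "v \<in> cball 0 r"
    then have "\<bar>v \<bullet> c\<bar> \<le> r * norm c" for c
      using Cauchy_Schwarz_ineq2[of v c] mult_right_mono[of "norm v" r "norm c"] by simp
    then have "\<bar>v \<bullet> c / (c \<bullet> c)\<bar> \<le> r * norm c / (c \<bullet> c)" for c
      by (simp add: divide_right_mono)
    then show "v \<in> ?K"
      using C(2)[of v] by (intro CollectI exI[of _ "\<lambda>c. v \<bullet> c / (c \<bullet> c)"]) simp
  qed
  then have "cball 0 r = ?K \<inter> cball 0 r"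
    by blast
  moreover have "compact (?K \<inter> cball 0 r)"
    by (intro compact_Int_closed compact_bounded_combinations C(1) closed_cball)
  ultimately have "compact (cball (0::'e) r)"
    by simp
  then have "compact ((+) x ` cball 0 r)"
    by (rule compact_translation)
  then show ?thesis
    by (simp add: cball_translation)
qed

text \<open>Expanding both arguments over a finite orthogonal set leaves only the matrix entries
  \<open>G x c d\<close> with fixed vectors. Their continuity in the base point then gives joint
  continuity in point and vector.\<close>

lemma continuous_on_quadratic_form:
  fixes B :: "'e::real_inner set" and G :: "'x::topological_space \<Rightarrow> 'e \<Rightarrow> 'e \<Rightarrow> real"
  assumes "finite B" "span B = UNIV"
    and bil: "\<And>x. x \<in> S \<Longrightarrow> bilinear (G x)"
    and cont: "\<And>v w. continuous_on S (\<lambda>x. G x v w)"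
  shows "continuous_on (S \<times> UNIV) (\<lambda>(x, v). G x v v)"
proof -
  obtain C :: "'e set" where C: "finite C" "\<And>v. v = (\<Sum>c\<in>C. (v \<bullet> c / (c \<bullet> c)) *\<^sub>R c)"
    using orthogonal_expansion[OF assms(1,2)] by metis
  have *: "G x v v = (\<Sum>(c, d)\<in>C \<times> C. (v \<bullet> c / (c \<bullet> c)) * ((v \<bullet> d / (d \<bullet> d)) * G x c d))" if "x \<in> S" for x v
  proof -
    have "G x v v = G x (\<Sum>c\<in>C. (v \<bullet> c / (c \<bullet> c)) *\<^sub>R c) (\<Sum>c\<in>C. (v \<bullet> c / (c \<bullet> c)) *\<^sub>R c)"
      using C(2)[of v] by simp
    also have "\<dots> = (\<Sum>(c, d)\<in>C \<times> C. G x ((v \<bullet> c / (c \<bullet> c)) *\<^sub>R c) ((v \<bullet> d / (d \<bullet> d)) *\<^sub>R d))"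
      by (rule bilinear_sum[OF bil[OF that]])
    finally show ?thesis
      by (simp add: bilinear_lmul[OF bil[OF that]] bilinear_rmul[OF bil[OF that]] ac_simps)
  qed
  have eq: "(\<lambda>(x, v). G x v v) y = (\<Sum>(c, d)\<in>C \<times> C. (snd y \<bullet> c / (c \<bullet> c)) * ((snd y \<bullet> d / (d \<bullet> d)) * G (fst y) c d))"
    if "y \<in> S \<times> UNIV" for y
  proof -
    have "fst y \<in> S" using that by auto
    from *[OF this, of "snd y"] show ?thesis by (simp only: case_prod_beta)
  qed
  have "continuous_on (S \<times> UNIV) (\<lambda>y. G (fst y) c d)" for c d
    by (rule continuous_on_compose2[OF cont]) (auto intro: continuous_intros)
  then have "continuous_on (S \<times> UNIV)
      (\<lambda>y. \<Sum>(c, d)\<in>C \<times> C. (snd y \<bullet> c / (c \<bullet> c)) * ((snd y \<bullet> d / (d \<bullet> d)) * G (fst y) c d))"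
    unfolding case_prod_beta divide_inverse
    by (intro continuous_intros) auto
  then show ?thesis
    using eq by (subst continuous_on_cong[OF refl eq]) 
qed

section \<open>Charts and lengths\<close>

lemma path_in_open_near:
  assumes "pathin M \<gamma>" "openin M W" "s \<in> {0..1}" "\<gamma> s \<in> W"
  obtains d where "0 < d" "\<And>u. u \<in> {0..1} \<Longrightarrow> \<bar>u - s\<bar> < d \<Longrightarrow> \<gamma> u \<in> W"
proof -
  have "openin (top_of_set {0..1}) {u \<in> {0..1}. \<gamma> u \<in> W}"
    using openin_continuous_map_preimage[OF assms(1)[unfolded pathin_def] assms(2)] by simp
  then obtain d where "0 < d" "\<forall>u\<in>{0..1}. dist u s < d \<longrightarrow> u \<in> {u \<in> {0..1}. \<gamma> u \<in> W}"
    unfolding openin_euclidean_subtopology_iff using assms(3,4) by blast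
  then show ?thesis
    using that[of d] by (auto simp: dist_real_def)
qed

text \<open>The domain is part of the condition because coordinate maps take arbitrary values
  outside it.\<close>

definition chart_preimage :: "('a, 'e) chart \<Rightarrow> 'e set \<Rightarrow> 'a set" where
  "chart_preimage c T = {q \<in> fst c. snd c q \<in> T}"

locale riemannian_manifold =
  fixes M :: "'a topology"
    and \<A> :: "('a, 'e::real_inner) chart set"
    and g :: "('a, 'e) metric_field"
  assumes manifold: "closed_manifold M \<A>"
    and metric: "riemannian_metric \<A> g"
begin

section \<open>Topology of charts and coordinate balls\<close>

lemma model_space_finite_span: obtains B :: "'e set" where "finite B" "span B = UNIV"
  using manifold unfolding closed_manifold_def smooth_atlas_def by blast

lemma chart:
  assumes "c \<in> \<A>"
  shows "openin M (fst c)" "open (snd c ` fst c)"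
    "homeomorphic_map (subtopology M (fst c)) (top_of_set (snd c ` fst c)) (snd c)"
proof -
  have "\<forall>(U, \<phi>)\<in>\<A>. openin M U \<and> open (\<phi> ` U) \<and>
        homeomorphic_map (subtopology M U) (top_of_set (\<phi> ` U)) \<phi>"
    using manifold unfolding closed_manifold_def smooth_atlas_def by (elim conjE)
  then have "case c of (U, \<phi>) \<Rightarrow> openin M U \<and> open (\<phi> ` U) \<and>
        homeomorphic_map (subtopology M U) (top_of_set (\<phi> ` U)) \<phi>"
    using assms by (rule bspec)
  then show "openin M (fst c)" "open (snd c ` fst c)"
    "homeomorphic_map (subtopology M (fst c)) (top_of_set (snd c ` fst c)) (snd c)"
    by (simp_all add: case_prod_beta)
qed

lemma chart_around:
  assumes "p \<in> topspace M" obtains c where "c \<in> \<A>" "p \<in> fst c"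
proof -
  have "\<Union>(fst ` \<A>) = topspace M"
    using manifold unfolding closed_manifold_def smooth_atlas_def by (elim conjE)
  then have "p \<in> \<Union>(fst ` \<A>)" using assms by simp
  then show ?thesis using that by blast
qed

lemma chart_subset: "c \<in> \<A> \<Longrightarrow> fst c \<subseteq> topspace M"
  using chart(1) openin_subset by blast

lemma topspace_chart: "c \<in> \<A> \<Longrightarrow> topspace (subtopology M (fst c)) = fst c"
  using chart_subset[of c] by (simp add: Int_absorb1)

lemma chart_inverse:
  assumes "c \<in> \<A>" "q \<in> fst c"
  shows "inv_into (fst c) (snd c) (snd c q) = q"
  using homeomorphic_imp_injective_map[OF chart(3)[OF assms(1)]] assms(2)
  unfolding topspace_chart[OF assms(1)] by (rule inv_into_f_f)

lemma continuous_map_chart: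
  assumes "c \<in> \<A>" shows "continuous_map (subtopology M (fst c)) euclidean (snd c)"
  using homeomorphic_imp_continuous_map[OF chart(3)[OF assms]] continuous_map_in_subtopology by blast

lemma openin_chart_preimage:
  assumes "c \<in> \<A>" "open T" shows "openin M (chart_preimage c T)"
proof -
  have "openin (subtopology M (fst c)) {q \<in> topspace (subtopology M (fst c)). snd c q \<in> T}"
    using assms by (intro openin_continuous_map_preimage[OF continuous_map_chart]) simp_all
  then show ?thesis
    unfolding topspace_chart[OF assms(1)] chart_preimage_def
    using chart(1)[OF assms(1)] by (rule openin_trans_full)
qed

lemma chart_preimage_homeomorphic:
  assumes "c \<in> \<A>" "K \<subseteq> snd c ` fst c"
  shows "subtopology M (chart_preimage c K) homeomorphic_space top_of_set K"
proof -
  have "snd c ` (topspace (subtopology M (fst c)) \<inter> chart_preimage c K) = topspace (top_of_set (snd c ` fst c)) \<inter> K"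
    unfolding topspace_chart[OF assms(1)] using assms(2) by (auto simp: chart_preimage_def)
  from homeomorphic_map_subtopologies[OF chart(3)[OF assms(1)] this]
  have "homeomorphic_map (subtopology (subtopology M (fst c)) (chart_preimage c K))
          (subtopology (top_of_set (snd c ` fst c)) K) (snd c)" .
  moreover have "fst c \<inter> chart_preimage c K = chart_preimage c K" "snd c ` fst c \<inter> K = K"
    using assms(2) by (auto simp: chart_preimage_def)
  ultimately have "homeomorphic_map (subtopology M (chart_preimage c K)) (top_of_set K) (snd c)"
    by (simp add: subtopology_subtopology)
  then show ?thesis
    by (rule homeomorphic_map_imp_homeomorphic_space)
qed

lemma chart_preimage_subset: "c \<in> \<A> \<Longrightarrow> chart_preimage c K \<subseteq> topspace M"
  using chart_subset[of c] unfolding chart_preimage_def by blast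

text \<open>Closedness in the coordinates would give closedness only relative to the chart domain.
  Compactness passes through the homeomorphism, and compact sets are closed in the Hausdorff space
  \<open>M\<close>.\<close>

lemma closedin_chart_preimage:
  assumes "c \<in> \<A>" "K \<subseteq> snd c ` fst c" "compact K"
  shows "closedin M (chart_preimage c K)"
proof -
  have "compact_space (top_of_set K)"
    using assms(3) by (simp add: compact_space_subtopology)
  then have "compact_space (subtopology M (chart_preimage c K))"
    using homeomorphic_compact_space[OF chart_preimage_homeomorphic[OF assms(1,2)]] by blast
  then have "compactin M (chart_preimage c K)"
    using chart_preimage_subset[OF assms(1)] by (simp add: compactin_subspace)
  moreover have "Hausdorff_space M"
    using manifold by (simp add: closed_manifold_def)
  ultimately show ?thesis
    by (intro compactin_imp_closedin)
qed

lemma contractible_chart_preimage: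
  assumes "c \<in> \<A>" "K \<subseteq> snd c ` fst c" "convex K"
  shows "contractible_space (subtopology M (chart_preimage c K))"
  using homeomorphic_space_contractibility[OF chart_preimage_homeomorphic[OF assms(1,2)]]
    convex_imp_contractible[OF assms(3)] by simp

lemma locally_path_connected_manifold: "locally_path_connected_space M"
  unfolding locally_path_connected_space
proof (intro allI impI)
  fix V x assume V: "openin M V \<and> x \<in> V"
  then have "x \<in> topspace M" using openin_subset by blast
  then obtain c where c: "c \<in> \<A>" "x \<in> fst c" by (rule chart_around)
  have "openin (subtopology M (fst c)) (fst c \<inter> V)"
    using V by (simp add: openin_subtopology_Int2)
  then have "openin (top_of_set (snd c ` fst c)) (snd c ` (fst c \<inter> V))"
    using homeomorphic_map_openness_eq[OF chart(3)[OF c(1)]] by blast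
  then have "open (snd c ` (fst c \<inter> V))"
    using chart(2)[OF c(1)] by (simp add: openin_open_eq)
  moreover have "snd c x \<in> snd c ` (fst c \<inter> V)"
    using V c(2) by blast
  ultimately obtain r where r: "r > 0" "ball (snd c x) r \<subseteq> snd c ` (fst c \<inter> V)"
    by (meson open_contains_ball)
  let ?W = "chart_preimage c (ball (snd c x) r)"
  have "contractible_space (subtopology M ?W)"
    using r by (intro contractible_chart_preimage[OF c(1)] convex_ball) blast
  then have "path_connectedin M ?W"
    using chart_preimage_subset[OF c(1)] contractible_imp_path_connected_space
    by (simp add: path_connectedin_def)
  moreover have "openin M ?W"
    by (intro openin_chart_preimage c(1) open_ball)
  moreover have "x \<in> ?W"
    using c(2) r(1) by (simp add: chart_preimage_def)
  moreover have "?W \<subseteq> V"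
  proof
    fix q assume q: "q \<in> ?W"
    then have "snd c q \<in> snd c ` (fst c \<inter> V)"
      using r(2) unfolding chart_preimage_def by blast
    then obtain q' where q': "q' \<in> fst c \<inter> V" "snd c q = snd c q'"
      by (rule imageE)
    moreover have "q \<in> fst c" using q by (simp add: chart_preimage_def)
    ultimately have "q = q'"
      using chart_inverse[OF c(1), of q] chart_inverse[OF c(1), of q'] by (metis IntD1)
    with q' show "q \<in> V" by simp
  qed
  ultimately show "\<exists>U. openin M U \<and> path_connectedin M U \<and> x \<in> U \<and> U \<subseteq> V"
    by blast
qed

section \<open>The metric in coordinates\<close>

lemma metric_chart:
  assumes "c \<in> \<A>" "p \<in> fst c"
  shows "bilinear (g c p)" "v \<noteq> 0 \<Longrightarrow> 0 < g c p v v"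
  using metric assms unfolding riemannian_metric_def by blast+

lemma metric_nonneg:
  assumes "c \<in> \<A>" "p \<in> fst c" shows "0 \<le> g c p v v"
  using metric_chart(2)[OF assms, of v] bilinear_lzero[OF metric_chart(1)[OF assms]] by (cases "v = 0") auto

lemma continuous_on_metric:
  assumes "c \<in> \<A>"
  shows "continuous_on (snd c ` fst c \<times> UNIV) (\<lambda>(x, v). g c (inv_into (fst c) (snd c) x) v v)"
proof -
  obtain B :: "'e set" where B: "finite B" "span B = UNIV" by (rule model_space_finite_span)
  have "\<forall>c\<in>\<A>. \<forall>v w. smooth_map_on (snd c ` fst c) (\<lambda>x. g c (inv_into (fst c) (snd c) x) v w)"
    using metric unfolding riemannian_metric_def by (elim conjE)
  then have "smooth_map_on (snd c ` fst c) (\<lambda>x. g c (inv_into (fst c) (snd c) x) v w)" for v w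
    using assms by blast
  then have "C_k_on 0 (snd c ` fst c) (\<lambda>x. g c (inv_into (fst c) (snd c) x) v w)" for v w
    unfolding smooth_map_on_def by blast
  then have "continuous_on (snd c ` fst c) (\<lambda>x. g c (inv_into (fst c) (snd c) x) v w)" for v w
    by simp
  moreover have "bilinear (g c (inv_into (fst c) (snd c) x))" if "x \<in> snd c ` fst c" for x
    using that by (intro metric_chart(1)[OF assms] inv_into_into)
  ultimately show ?thesis
    using continuous_on_quadratic_form[OF B, of "snd c ` fst c" "\<lambda>x. g c (inv_into (fst c) (snd c) x)"] by blast
qed

lemma compact_cball_model: "compact (cball (x :: 'e) r)"
  using model_space_finite_span compact_cball_finite_span by metis

text \<open>The quadratic form attains a positive minimum on the product of \<open>K\<close> with
  the unit sphere, and homogeneity extends the estimate to all vectors. It makes coordinate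
  displacement controllable by Riemannian length.\<close>

lemma metric_lower_bound:
  assumes c: "c \<in> \<A>" and K: "compact K" "K \<subseteq> snd c ` fst c"
  obtains m where "0 < m" "\<And>q v. q \<in> chart_preimage c K \<Longrightarrow> m * norm v \<le> sqrt (g c q v v)"
proof (cases "K \<times> sphere (0::'e) 1 = {}")
  case True  \<comment> \<open>includes the model space of dimension \<open>0\<close>, whose unit sphere is empty\<close>
  have "1 * norm v \<le> sqrt (g c q v v)" if q: "q \<in> chart_preimage c K" for q v
  proof -
    have "sphere (0::'e) 1 = {}"
      using True q by (auto simp: chart_preimage_def)
    then have "v = 0"
      using norm_sgn[of v] by (metis empty_iff mem_sphere_0)
    then show ?thesis
      using q metric_nonneg[OF c] by (simp add: chart_preimage_def)
  qed
  then show ?thesis using that[of 1] by simp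
next
  case False
  let ?G = "\<lambda>(x, v). g c (inv_into (fst c) (snd c) x) v v"
  have "sphere (0::'e) 1 = cball 0 1 - ball 0 1"
    by auto
  then have "compact (sphere (0::'e) 1)"
    using compact_diff[OF compact_cball_model open_ball] by simp
  then have "compact (K \<times> sphere (0::'e) 1)"
    using K(1) by (rule compact_Times[rotated])
  moreover have "continuous_on (K \<times> sphere 0 1) ?G"
    using continuous_on_metric[OF c] by (rule continuous_on_subset) (use K(2) in auto)
  ultimately obtain y where y: "y \<in> K \<times> sphere 0 1" "\<And>z. z \<in> K \<times> sphere 0 1 \<Longrightarrow> ?G y \<le> ?G z"
    using continuous_attains_inf[OF _ False] by blast
  have "snd y \<noteq> 0" "fst y \<in> snd c ` fst c" using y(1) K(2) by auto
  then have "0 < ?G y"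
    using metric_chart(2)[OF c inv_into_into[of "fst y" "snd c"]] by (simp add: case_prod_beta)
  moreover have "sqrt (?G y) * norm v \<le> sqrt (g c q v v)" if q: "q \<in> chart_preimage c K" for q v
  proof (cases "v = 0")
    case True
    then show ?thesis using q metric_nonneg[OF c] by (simp add: chart_preimage_def)
  next
    case False
    have qc: "q \<in> fst c" "snd c q \<in> K" using q by (auto simp: chart_preimage_def)
    have "?G y \<le> ?G (snd c q, v /\<^sub>R norm v)"
      using qc False by (intro y(2)) simp
    also have "\<dots> = g c q v v / (norm v)\<^sup>2"
      using chart_inverse[OF c qc(1)] metric_chart(1)[OF c qc(1)]
      by (simp add: bilinear_lmul bilinear_rmul power2_eq_square field_simps)
    finally have "?G y * (norm v)\<^sup>2 \<le> g c q v v"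
      using False by (simp add: pos_le_divide_eq)
    then have "sqrt (?G y * (norm v)\<^sup>2) \<le> sqrt (g c q v v)"
      by (rule real_sqrt_le_mono)
    then show ?thesis by (simp add: real_sqrt_mult)
  qed
  ultimately show ?thesis using that[of "sqrt (?G y)"] by simp
qed


section \<open>Speed and length of piecewise smooth paths\<close>

lemma smooth_curve_in_chart:
  assumes "c \<in> \<A>" "smooth_curve_on \<A> a b \<gamma>" "\<gamma> ` {a..b} \<subseteq> fst c"
  obtains D' where "continuous_on {a..b} D'"
    "\<And>s. s \<in> {a..b} \<Longrightarrow> ((snd c \<circ> \<gamma>) has_vector_derivative D' s) (at s within {a..b})"
proof -
  have S: "{s \<in> {a..b}. \<gamma> s \<in> fst c} = {a..b}"
    using assms(3) by blast
  have "case c of (U, \<phi>) \<Rightarrow> let S = {s \<in> {a..b}. \<gamma> s \<in> U} in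
        \<exists>D :: nat \<Rightarrow> real \<Rightarrow> 'e. (\<forall>s\<in>S. D 0 s = \<phi> (\<gamma> s)) \<and>
          (\<forall>k. \<forall>s\<in>S. (D k has_vector_derivative D (Suc k) s) (at s within S))"
    using assms(2) assms(1) unfolding smooth_curve_on_def by (rule bspec)
  then obtain D :: "nat \<Rightarrow> real \<Rightarrow> 'e" where D0: "\<forall>s\<in>{a..b}. D 0 s = snd c (\<gamma> s)"
    and D: "\<forall>k. \<forall>s\<in>{a..b}. (D k has_vector_derivative D (Suc k) s) (at s within {a..b})"
    unfolding case_prod_beta Let_def S by (elim exE conjE)
  \<comment> \<open>Continuity of the first derivative comes from its own differentiability, that
    is, from the next member of the list \<open>D\<close>.\<close>
  have "continuous_on {a..b} (D 1)"
    using D has_vector_derivative_continuous unfolding continuous_on_eq_continuous_within by blast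
  moreover have "((snd c \<circ> \<gamma>) has_vector_derivative D 1 s) (at s within {a..b})" if "s \<in> {a..b}" for s
  proof (rule has_vector_derivative_transform[OF that])
    show "(D 0 has_vector_derivative D 1 s) (at s within {a..b})"
      using D that by simp
  qed (use D0 in simp)
  ultimately show ?thesis by (rule that)
qed

lemma transition_has_derivative:
  assumes "c \<in> \<A>" "d \<in> \<A>" "p \<in> fst c \<inter> fst d"
  shows "(transition c d has_derivative frechet_derivative (transition c d) (at (snd c p))) (at (snd c p))"
proof -
  have "\<forall>c\<in>\<A>. \<forall>d\<in>\<A>. smooth_map_on (snd c ` (fst c \<inter> fst d)) (transition c d)"
    using manifold unfolding closed_manifold_def smooth_atlas_def by (elim conjE)
  then have "C_k_on (Suc 0) (snd c ` (fst c \<inter> fst d)) (transition c d)"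
    using assms(1,2) unfolding smooth_map_on_def by blast
  then have "transition c d differentiable (at (snd c p))"
    using assms(3) by simp
  then show ?thesis
    by (simp add: frechet_derivative_works)
qed

lemma metric_transition:
  assumes "c \<in> \<A>" "d \<in> \<A>" "p \<in> fst c \<inter> fst d"
  shows "g c p v w = g d p (frechet_derivative (transition c d) (at (snd c p)) v)
                          (frechet_derivative (transition c d) (at (snd c p)) w)"
proof -
  have "\<forall>c\<in>\<A>. \<forall>d\<in>\<A>. \<forall>p\<in>fst c \<inter> fst d. \<forall>v w.
        g c p v w = g d p (frechet_derivative (transition c d) (at (snd c p)) v)
                          (frechet_derivative (transition c d) (at (snd c p)) w)"
    using metric unfolding riemannian_metric_def by (elim conjE)
  then show ?thesis using assms by blast
qed

text \<open>The speed is defined through a chart picked by \<open>SOME\<close>. The chain rule for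
  the transition map and the transformation law of the metric allow any other chart to be used
  instead. The time is interior because the derivative in the definition is two-sided.\<close>

lemma riemannian_speed_eq:
  assumes \<gamma>: "pathin M \<gamma>" and s: "s \<in> {0<..<1}" and c: "c \<in> \<A>" "\<gamma> s \<in> fst c"
    and v: "((snd c \<circ> \<gamma>) has_vector_derivative v) (at s)"
  shows "riemannian_speed \<A> g \<gamma> s = sqrt (g c (\<gamma> s) v v)"
proof -
  define d where "d = (SOME d. d \<in> \<A> \<and> \<gamma> s \<in> fst d)"
  have d: "d \<in> \<A>" "\<gamma> s \<in> fst d"
    using someI[of "\<lambda>d. d \<in> \<A> \<and> \<gamma> s \<in> fst d" c] c unfolding d_def by auto
  let ?T = "transition c d"
  let ?T' = "frechet_derivative ?T (at (snd c (\<gamma> s)))"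
  have p: "\<gamma> s \<in> fst c \<inter> fst d" using c d by simp
  obtain e where e: "0 < e" "\<And>u. u \<in> {0..1} \<Longrightarrow> \<bar>u - s\<bar> < e \<Longrightarrow> \<gamma> u \<in> fst c \<inter> fst d"
    using path_in_open_near[OF \<gamma> openin_Int[OF chart(1)[OF c(1)] chart(1)[OF d(1)]] _ p] s by auto
  have T: "(?T has_derivative ?T') (at (snd c (\<gamma> s)))"
    using transition_has_derivative[OF c(1) d(1) p] .
  have "((?T \<circ> (snd c \<circ> \<gamma>)) has_derivative (?T' \<circ> (\<lambda>t. t *\<^sub>R v))) (at s)"
    using v T unfolding has_vector_derivative_def by (intro diff_chain_at) simp_all
  moreover have "?T' \<circ> (\<lambda>t. t *\<^sub>R v) = (\<lambda>t. t *\<^sub>R ?T' v)"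
    using linear_scale[OF has_derivative_linear[OF T]] by (simp add: fun_eq_iff)
  ultimately have "((?T \<circ> (snd c \<circ> \<gamma>)) has_vector_derivative ?T' v) (at s)"
    unfolding has_vector_derivative_def by simp
  then have "((snd d \<circ> \<gamma>) has_vector_derivative ?T' v) (at s)"
  proof (rule has_vector_derivative_transform_within_open)
    show "open ({0<..<1} \<inter> ball s e)" "s \<in> {0<..<1} \<inter> ball s e"
      using s e(1) by auto
    fix u assume "u \<in> {0<..<1} \<inter> ball s e"
    then have "\<gamma> u \<in> fst c \<inter> fst d"
      by (intro e(2)) (auto simp: dist_real_def)
    then show "(?T \<circ> (snd c \<circ> \<gamma>)) u = (snd d \<circ> \<gamma>) u"
      using chart_inverse[OF c(1), of "\<gamma> u"] by (simp add: transition_def)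
  qed
  then have "vector_derivative (snd d \<circ> \<gamma>) (at s) = ?T' v"
    by (rule vector_derivative_at)
  then show ?thesis
    unfolding riemannian_speed_def d_def[symmetric] Let_def
    using metric_transition[OF c(1) d(1) p, of v v] by simp
qed

lemma riemannian_speed_nonneg:
  assumes "\<gamma> s \<in> topspace M"
  shows "0 \<le> riemannian_speed \<A> g \<gamma> s"
proof -
  define d where "d = (SOME d. d \<in> \<A> \<and> \<gamma> s \<in> fst d)"
  obtain c where "c \<in> \<A>" "\<gamma> s \<in> fst c"
    using assms by (rule chart_around)
  then have "d \<in> \<A>" "\<gamma> s \<in> fst d"
    using someI[of "\<lambda>d. d \<in> \<A> \<and> \<gamma> s \<in> fst d" c] unfolding d_def by auto
  then show ?thesis
    unfolding riemannian_speed_def d_def[symmetric] Let_def by (simp add: metric_nonneg)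
qed

text \<open>Inside the interval the speed equals a continuous expression in the coordinates and
  their derivative. At \<open>a\<close> and \<open>b\<close> the two-sided derivative may fail to
  exist, but two points do not affect integrability. Smoothness is asked only for
  \<open>a < b\<close>, as piecewise smoothness speaks of nondegenerate intervals.\<close>

lemma speed_integrable_in_chart:
  assumes \<gamma>: "pathin M \<gamma>" and ab: "0 \<le> a" "a \<le> b" "b \<le> 1" and c: "c \<in> \<A>" "\<gamma> ` {a..b} \<subseteq> fst c"
    and smooth: "a < b \<Longrightarrow> smooth_curve_on \<A> a b \<gamma>"
  shows "riemannian_speed \<A> g \<gamma> integrable_on {a..b}"
proof (cases "a = b")
  case False
  then have "a < b" using ab by simp
  obtain D' where D': "continuous_on {a..b} D'"
    "\<And>s. s \<in> {a..b} \<Longrightarrow> ((snd c \<circ> \<gamma>) has_vector_derivative D' s) (at s within {a..b})"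
    using smooth_curve_in_chart[OF c(1) smooth[OF \<open>a < b\<close>] c(2)] by blast
  let ?G = "\<lambda>(x, v). g c (inv_into (fst c) (snd c) x) v v"
  have "continuous_on {a..b} (snd c \<circ> \<gamma>)"
    using D'(2) has_vector_derivative_continuous unfolding continuous_on_eq_continuous_within by blast
  then have "continuous_on {a..b} (\<lambda>s. ?G (snd c (\<gamma> s), D' s))"
    using D'(1) c(2)
    by (intro continuous_on_compose2[OF continuous_on_metric[OF c(1)]]) (auto intro!: continuous_on_Pair simp: comp_def)
  then have "(\<lambda>s. sqrt (?G (snd c (\<gamma> s), D' s))) integrable_on {a..b}"
    by (intro integrable_continuous_real continuous_on_real_sqrt)
  then show ?thesis
  proof (rule integrable_spike_finite[rotated 2])
    show "finite {a, b}" by simp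
    fix s assume s: "s \<in> {a..b} - {a, b}"
    then have "((snd c \<circ> \<gamma>) has_vector_derivative D' s) (at s)"
      using D'(2)[of s] at_within_interior[of s "{a..b}"] by simp
    moreover have "\<gamma> s \<in> fst c" using s c(2) by auto
    ultimately show "riemannian_speed \<A> g \<gamma> s = sqrt (?G (snd c (\<gamma> s), D' s))"
      using riemannian_speed_eq[OF \<gamma> _ c(1), of s] s ab chart_inverse[OF c(1)] by simp
  qed
qed (use integrable_on_refl[of "riemannian_speed \<A> g \<gamma>" a] in simp)

text \<open>Without integrability the length would be the junk value \<open>0\<close>.\<close>

lemma speed_integrable:
  assumes "piecewise_smooth_path M \<A> \<gamma>"
  shows "riemannian_speed \<A> g \<gamma> integrable_on {0..1}"
proof -
  have \<gamma>: "pathin M \<gamma>"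
    using assms by (simp add: piecewise_smooth_path_def)
  obtain B where B: "finite B"
    and smooth: "\<And>a b. 0 \<le> a \<Longrightarrow> a < b \<Longrightarrow> b \<le> 1 \<Longrightarrow> {a<..<b} \<inter> B = {} \<Longrightarrow> smooth_curve_on \<A> a b \<gamma>"
    using assms unfolding piecewise_smooth_path_def by blast
  let ?f = "riemannian_speed \<A> g \<gamma>"
  let ?P = "\<lambda>u v. 0 \<le> u \<longrightarrow> v \<le> 1 \<longrightarrow> ?f integrable_on {u..v}"
  have "?P 0 1"
  proof (rule Bolzano[where P = ?P])
    show "?P u w" if "?P u v" "?P v w" "u \<le> v" "v \<le> w" for u v w
      using that Henstock_Kurzweil_Integration.integrable_combine[of u v w ?f] by auto
  next
    fix x :: real assume "0 \<le> x" "x \<le> 1"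
    then have x: "x \<in> {0..1}" by simp
    then have "\<gamma> x \<in> topspace M"
      using \<gamma> by (auto simp: pathin_def continuous_map_def)
    then obtain c where c: "c \<in> \<A>" "\<gamma> x \<in> fst c" by (rule chart_around)
    obtain d where d: "0 < d" "\<And>u. u \<in> {0..1} \<Longrightarrow> \<bar>u - x\<bar> < d \<Longrightarrow> \<gamma> u \<in> fst c"
      using path_in_open_near[OF \<gamma> chart(1)[OF c(1)] x c(2)] by blast
    \<comment> \<open>Within distance \<open>e\<close> only \<open>x\<close> itself can be a break
      point. Short intervals with \<open>x\<close> as an end point thus have none inside, which is
      why an interval around \<open>x\<close> is treated in two halves.\<close>
    obtain e where e: "0 < e" "\<And>y. y \<in> B \<Longrightarrow> y \<noteq> x \<Longrightarrow> e \<le> \<bar>x - y\<bar>"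
      using finite_set_avoid[OF B, of x] by (auto simp: dist_real_def)
    have piece: "?f integrable_on {u..v}"
      if "0 \<le> u" "u \<le> v" "v \<le> 1" "v - u < min d e" "x = u \<or> x = v" for u v
    proof (rule speed_integrable_in_chart[OF \<gamma> that(1-3) c(1)])
      show "\<gamma> ` {u..v} \<subseteq> fst c"
        using that d(2) by fastforce
      have "{u<..<v} \<inter> B = {}"
        using that e(2) by fastforce
      then show "smooth_curve_on \<A> u v \<gamma>" if "u < v"
        using smooth that \<open>0 \<le> u\<close> \<open>v \<le> 1\<close> by blast
    qed
    show "\<exists>d>0. \<forall>u v. u \<le> x \<and> x \<le> v \<and> v - u < d \<longrightarrow> ?P u v"
    proof (intro exI[of _ "min d e"] conjI allI impI)
      show "0 < min d e" using d e by simp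
      fix u v assume uv: "u \<le> x \<and> x \<le> v \<and> v - u < min d e" "0 \<le> u" "v \<le> 1"
      then have "?f integrable_on {u..x}" "?f integrable_on {x..v}"
        by (auto intro!: piece)
      then show "?f integrable_on {u..v}"
        using uv Henstock_Kurzweil_Integration.integrable_combine[of u x v ?f] by auto
    qed
  qed simp
  then show ?thesis by simp
qed


text \<open>
  On leaving the ball for the first time, at time \<open>e\<close>, the coordinates have moved by a vector \<open>u\<close> with
  \<open>r < norm u\<close>; integrating the derivative of the component along \<open>u\<close> bounds \<open>m * norm u\<close> by the length.
\<close>

lemma short_path_stays_in_chart_ball:
  assumes ps: "piecewise_smooth_path M \<A> \<gamma>" and ab: "0 \<le> a" "a \<le> b" "b \<le> 1"
    and c: "c \<in> \<A>" and ball: "cball x (2 * r) \<subseteq> snd c ` fst c"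
    and m: "0 < m" "\<And>q v. q \<in> chart_preimage c (cball x (2 * r)) \<Longrightarrow> m * norm v \<le> sqrt (g c q v v)"
    and start: "\<gamma> a \<in> chart_preimage c (ball x r)"
    and short: "integral {a..b} (riemannian_speed \<A> g \<gamma>) < m * r"
  shows "\<gamma> ` {a..b} \<subseteq> chart_preimage c (cball x (2 * r))"
proof (rule ccontr)
  let ?f = "riemannian_speed \<A> g \<gamma>"
  let ?V = "chart_preimage c (ball x (2 * r))" and ?K = "chart_preimage c (cball x (2 * r))"
  assume "\<not> \<gamma> ` {a..b} \<subseteq> ?K"
  have \<gamma>: "pathin M \<gamma>"
    using ps by (simp add: piecewise_smooth_path_def)
  have cont: "continuous_map (top_of_set {a..b}) M \<gamma>"
    using continuous_map_from_subtopology_mono[OF \<gamma>[unfolded pathin_def], of "{a..b}"] ab by auto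
  have in_M: "\<gamma> s \<in> topspace M" if "s \<in> {a..b}" for s
    using cont that by (auto simp: continuous_map_def)
  have "0 < r"
    using start zero_le_dist[of x "snd c (\<gamma> a)"] by (auto simp: chart_preimage_def simp del: zero_le_dist)
  have "closedin (top_of_set {a..b}) {s \<in> {a..b}. \<gamma> s \<in> topspace M - ?V}"
    using closedin_continuous_map_preimage[OF cont, of "topspace M - ?V"] openin_chart_preimage[OF c]
    by (simp add: closedin_diff)
  then have closed: "closed {s \<in> {a..b}. \<gamma> s \<in> topspace M - ?V}" (is "closed ?T")
    using closedin_closed_trans closed_atLeastAtMost by blast
  have "?V \<subseteq> ?K"
    by (auto simp: chart_preimage_def)
  then have "?T \<noteq> {}"
    using \<open>\<not> \<gamma> ` {a..b} \<subseteq> ?K\<close> in_M by auto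
  define e where "e = Inf ?T"
  have "bdd_below ?T"
    by (rule bdd_belowI[of _ a]) simp
  then have eT: "e \<in> ?T"
    unfolding e_def using \<open>?T \<noteq> {}\<close> closed by (intro closed_contains_Inf)
  then have e: "e \<in> {a..b}" "\<gamma> e \<notin> ?V"
    by auto
  have before: "\<gamma> s \<in> ?V" if "s \<in> {a..<e}" for s
  proof (rule ccontr)
    assume "\<gamma> s \<notin> ?V"
    then have "s \<in> ?T"
      using that e(1) in_M by auto
    then have "e \<le> s"
      unfolding e_def using \<open>bdd_below ?T\<close> by (rule cInf_lower)
    then show False using that by simp
  qed
  have "\<gamma> a \<in> ?V"
    using start \<open>0 < r\<close> by (auto simp: chart_preimage_def)
  then have "a < e"
    using e by (cases "a = e") auto
  \<comment> \<open>At the exit time the path has left the open ball, but closedness of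
    \<open>?K\<close> keeps it in the closed ball. So the chart and the lower bound of the metric
    remain available on all of \<open>{a..e}\<close>.\<close>
  have "closedin (top_of_set {a..b}) {s \<in> {a..b}. \<gamma> s \<in> ?K}"
    using closedin_continuous_map_preimage[OF cont closedin_chart_preimage[OF c ball compact_cball_model]] by simp
  then have "closed {s \<in> {a..b}. \<gamma> s \<in> ?K}"
    using closedin_closed_trans closed_atLeastAtMost by blast
  moreover have "{a..<e} \<subseteq> {s \<in> {a..b}. \<gamma> s \<in> ?K}"
    using before \<open>?V \<subseteq> ?K\<close> e(1) by auto
  ultimately have "closure {a..<e} \<subseteq> {s \<in> {a..b}. \<gamma> s \<in> ?K}"
    by (rule closure_minimal[rotated])
  then have inK: "\<gamma> s \<in> ?K" if "s \<in> {a..e}" for s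
    using that \<open>a < e\<close> by auto
  then have in_chart: "\<gamma> ` {a..e} \<subseteq> fst c"
    by (auto simp: chart_preimage_def)
  define u where "u = snd c (\<gamma> e) - snd c (\<gamma> a)"
  have "\<gamma> e \<in> fst c"
    using in_chart \<open>a < e\<close> by auto
  then have "\<not> dist x (snd c (\<gamma> e)) < 2 * r"
    using e(2) by (simp add: chart_preimage_def)
  moreover have "dist x (snd c (\<gamma> a)) < r"
    using start by (simp add: chart_preimage_def)
  moreover have "dist x (snd c (\<gamma> e)) \<le> dist x (snd c (\<gamma> a)) + norm u"
    using dist_triangle[of x "snd c (\<gamma> e)" "snd c (\<gamma> a)"] by (simp add: u_def dist_norm norm_minus_commute)
  ultimately have "r < norm u"
    by linarith
  obtain B where B: "finite B"
    and smooth: "\<And>a b. 0 \<le> a \<Longrightarrow> a < b \<Longrightarrow> b \<le> 1 \<Longrightarrow> {a<..<b} \<inter> B = {} \<Longrightarrow> smooth_curve_on \<A> a b \<gamma>"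
    using ps unfolding piecewise_smooth_path_def by blast
  have deriv: "\<exists>v. ((snd c \<circ> \<gamma>) has_vector_derivative v) (at s)" if s: "s \<in> {a<..<e} - B" for s
  proof -
    obtain d where d: "0 < d" "\<And>y. y \<in> B \<Longrightarrow> y \<noteq> s \<Longrightarrow> d \<le> \<bar>s - y\<bar>"
      using finite_set_avoid[OF B, of s] by (auto simp: dist_real_def)
    define l where "l = min d (min (s - a) (e - s))"
    have l: "0 < l" "l \<le> d" "a \<le> s - l" "s + l \<le> e"
      using s d(1) by (auto simp: l_def)
    have "{s - l<..<s + l} \<inter> B = {}"
    proof (rule ccontr)
      assume "{s - l<..<s + l} \<inter> B \<noteq> {}"
      then obtain y where y: "y \<in> B" "s - l < y" "y < s + l" by auto
      then have "y \<noteq> s" using s by auto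
      with d(2)[OF y(1)] y(2,3) l(2) show False by linarith
    qed
    then have "smooth_curve_on \<A> (s - l) (s + l) \<gamma>"
      using l ab e(1) by (intro smooth) auto
    moreover have "\<gamma> ` {s - l..s + l} \<subseteq> fst c"
      using in_chart l by (meson atLeastatMost_subset_iff image_mono order_trans)
    ultimately obtain D' where "\<And>t. t \<in> {s - l..s + l} \<Longrightarrow>
        ((snd c \<circ> \<gamma>) has_vector_derivative D' t) (at t within {s - l..s + l})"
      using smooth_curve_in_chart[OF c] by blast
    from this[of s] have "((snd c \<circ> \<gamma>) has_vector_derivative D' s) (at s)"
      using at_within_interior[of s "{s - l..s + l}"] l by simp
    then show ?thesis by blast
  qed
  then obtain D' where D': "\<And>s. s \<in> {a<..<e} - B \<Longrightarrow> ((snd c \<circ> \<gamma>) has_vector_derivative D' s) (at s)"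
    by metis
  let ?h = "\<lambda>s. snd c (\<gamma> s) \<bullet> u"
  \<comment> \<open>At the finitely many exceptional times the value 0 does not affect the integral,
    and it lies below the nonnegative speed, so the pointwise comparison holds everywhere on
    \<open>{a..e}\<close>.\<close>
  define h' where "h' s = (if s \<in> {a<..<e} - B then D' s \<bullet> u else 0)" for s
  have "continuous_map (top_of_set {a..e}) (subtopology M (fst c)) \<gamma>"
    using continuous_map_from_subtopology_mono[OF \<gamma>[unfolded pathin_def], of "{a..e}"] ab e in_chart
    by (auto simp: continuous_map_in_subtopology)
  then have "continuous_map (top_of_set {a..e}) euclidean (snd c \<circ> \<gamma>)"
    using continuous_map_chart[OF c] by (rule continuous_map_compose)
  then have "continuous_on {a..e} ?h"
    by (auto simp: comp_def intro!: continuous_intros)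
  moreover have "(?h has_vector_derivative h' s) (at s)" if "s \<in> {a<..<e} - B" for s
    using bounded_linear.has_vector_derivative[OF bounded_linear_inner_left[of u] D'[OF that]] that
    by (simp add: h'_def comp_def)
  ultimately have h': "(h' has_integral (?h e - ?h a)) {a..e}"
    using \<open>a < e\<close> by (intro fundamental_theorem_of_calculus_interior_strong[OF B]) auto
  have int: "?f integrable_on {a..b}"
    using speed_integrable[OF ps] by (rule integrable_on_subinterval) (use ab in auto)
  then have int_e: "?f integrable_on {a..e}"
    by (rule integrable_on_subinterval) (use e(1) in auto)
  have le: "h' s \<le> norm u / m * ?f s" if s: "s \<in> {a..e}" for s
  proof (cases "s \<in> {a<..<e} - B")
    case True
    have "?f s = sqrt (g c (\<gamma> s) (D' s) (D' s))"
      using True ab e in_chart by (intro riemannian_speed_eq[OF \<gamma> _ c _ D'[OF True]]) auto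
    then have "m * norm (D' s) \<le> ?f s"
      using m(2)[OF inK[OF s], of "D' s"] by simp
    then have "norm (D' s) \<le> ?f s / m"
      using m(1) by (simp add: field_simps)
    have "h' s \<le> norm (D' s) * norm u"
      using True by (simp add: h'_def norm_cauchy_schwarz)
    also have "\<dots> \<le> ?f s / m * norm u"
      using \<open>norm (D' s) \<le> ?f s / m\<close> by (rule mult_right_mono) simp
    finally show ?thesis by (simp add: field_simps)
  next
    case False
    have "0 \<le> ?f s"
      using s e(1) in_M by (intro riemannian_speed_nonneg) auto
    moreover have "h' s = 0"
      using False by (simp only: h'_def if_False)
    ultimately show ?thesis
      using m(1) by simp
  qed
  have "(norm u)\<^sup>2 = ?h e - ?h a"
    by (simp add: u_def power2_norm_eq_inner inner_diff_left)
  also have "\<dots> \<le> norm u / m * integral {a..e} ?f"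
    using h' has_integral_mult_right[OF integrable_integral[OF int_e]] le by (rule has_integral_le)
  also have "\<dots> \<le> norm u / m * integral {a..b} ?f"
  proof (rule mult_left_mono)
    show "integral {a..e} ?f \<le> integral {a..b} ?f"
      using int_e int
      by (rule integral_subset_le[rotated])
        (use e(1) in \<open>auto intro!: riemannian_speed_nonneg in_M\<close>)
  qed (use m(1) in simp)
  also have "\<dots> < norm u / m * (m * r)"
  proof (rule mult_strict_left_mono[OF short])
    show "0 < norm u / m"
      using \<open>r < norm u\<close> \<open>0 < r\<close> m(1) by (intro divide_pos_pos) auto
  qed
  also have "\<dots> = norm u * r"
    using m(1) by simp
  also have "\<dots> \<le> (norm u)\<^sup>2"
    unfolding power2_eq_square using \<open>r < norm u\<close> by (intro mult_left_mono) auto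
  finally show False by simp
qed

end

text \<open>Every step either reaches 1, where all later steps remain, or raises \<open>F\<close> by
  at least \<delta>. As \<open>F\<close> starts nonnegative and is bounded by \<open>L\<close>, it
  cannot be raised \<open>n\<close> times. \<open>F\<close> will be the length used up so
  far.\<close>

lemma greedy_subdivision:
  fixes F :: "real \<Rightarrow> real"
  assumes step: "\<And>a. a \<in> {0..1} \<Longrightarrow> \<exists>b\<in>{a..1}. P a b \<and> (b = 1 \<or> F a + \<delta> \<le> F b)"
    and F: "0 \<le> F 0" "\<And>a. a \<in> {0..1} \<Longrightarrow> F a \<le> L" and n: "L < real n * \<delta>"
  obtains t :: "nat \<Rightarrow> real" where "t 0 = 0" "t n = 1" "\<And>k. t k \<le> t (Suc k) \<and> P (t k) (t (Suc k))"
proof -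
  obtain b where b: "\<And>a. a \<in> {0..1} \<Longrightarrow> b a \<in> {a..1} \<and> P a (b a) \<and> (b a = 1 \<or> F a + \<delta> \<le> F (b a))"
    using step by metis
  define t where "t k = (b ^^ k) 0" for k
  have Suc: "t (Suc k) = b (t k)" for k
    by (simp add: t_def)
  have t01: "t k \<in> {0..1}" for k
  proof (induction k)
    case (Suc k)
    then show ?case using b[of "t k"] by (auto simp: \<open>\<And>k. t (Suc k) = b (t k)\<close>)
  qed (simp add: t_def)
  have "t k = 1 \<or> real k * \<delta> \<le> F (t k)" for k
  proof (induction k)
    case (Suc k)
    then show ?case using b[OF t01[of k]] by (auto simp: \<open>\<And>k. t (Suc k) = b (t k)\<close> algebra_simps)
  qed (simp add: t_def F)
  from this[of n] have "t n = 1"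
    using F(2)[OF t01[of n]] n by auto
  moreover have "t 0 = 0" by (simp add: t_def)
  moreover have "t k \<le> t (Suc k) \<and> P (t k) (t (Suc k))" for k
    using b[OF t01[of k]] by (simp add: Suc)
  ultimately show ?thesis using that by blast
qed

context riemannian_manifold
begin

text \<open>The balls, the step length \<delta> and the number \<open>n\<close> of pieces are fixed
  before any path is considered, so the finite set \<open>C\<close> serves all paths of length at
  most \<open>L\<close>.\<close>

lemma finitely_many_classes_of_bounded_length:
  obtains C where "finite C"
    and "\<And>\<sigma> \<sigma>'. piecewise_smooth_path M \<A> \<sigma> \<Longrightarrow> piecewise_smooth_path M \<A> \<sigma>' \<Longrightarrow>
           \<sigma> 0 = \<sigma>' 0 \<Longrightarrow> \<sigma> 1 = \<sigma>' 1 \<Longrightarrow>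
           riemannian_length \<A> g \<sigma> \<le> L \<Longrightarrow> riemannian_length \<A> g \<sigma>' \<le> L \<Longrightarrow>
           \<exists>c\<in>C. homologous_rel 1 M {} (path_chain \<sigma> - path_chain \<sigma>') c"
proof -
  \<comment> \<open>The estimate for the metric is required on the ball of radius
    \<open>2 * r\<close>, where short pieces stay. The larger radius \<open>3 * r\<close> leaves
    room for an open convex neighbourhood of that closed ball inside the chart.\<close>
  define good where "good p = (\<lambda>(c, r, m). c \<in> \<A> \<and> p \<in> fst c \<and> 0 < r \<and> 0 < m \<and>
      cball (snd c p) (3 * r) \<subseteq> snd c ` fst c \<and>
      (\<forall>q\<in>chart_preimage c (cball (snd c p) (2 * r)). \<forall>v. m * norm v \<le> sqrt (g c q v v)))" for p
  have "\<exists>y. good p y" if p: "p \<in> topspace M" for p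
  proof -
    obtain c where c: "c \<in> \<A>" "p \<in> fst c" using p by (rule chart_around)
    then obtain r where r: "r > 0" "cball (snd c p) r \<subseteq> snd c ` fst c"
      using chart(2)[OF c(1)] by (meson imageI open_contains_cball)
    have "cball (snd c p) (2 * (r / 3)) \<subseteq> cball (snd c p) r"
      using r(1) by (intro subset_cball) simp
    then obtain m where "0 < m"
      "\<And>q v. q \<in> chart_preimage c (cball (snd c p) (2 * (r / 3))) \<Longrightarrow> m * norm v \<le> sqrt (g c q v v)"
      using metric_lower_bound[OF c(1) compact_cball_model, of "snd c p" "2 * (r / 3)"] r(2) by blast
    then have "good p (c, r / 3, m)"
      using c r by (simp add: good_def)
    then show ?thesis by blast
  qed
  then obtain y where y: "\<And>p. p \<in> topspace M \<Longrightarrow> good p (y p)"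
    by metis
  define c where "c p = fst (y p)" for p
  define r where "r p = fst (snd (y p))" for p
  define m where "m p = snd (snd (y p))" for p
  have good: "c p \<in> \<A>" "p \<in> fst (c p)" "0 < r p" "0 < m p" "cball (snd (c p) p) (3 * r p) \<subseteq> snd (c p) ` fst (c p)"
    and lower: "\<And>q v. q \<in> chart_preimage (c p) (cball (snd (c p) p) (2 * r p)) \<Longrightarrow> m p * norm v \<le> sqrt (g (c p) q v v)"
    if "p \<in> topspace M" for p
    using y[OF that] by (auto simp: good_def c_def r_def m_def case_prod_beta)
  define V where "V p \<rho> = chart_preimage (c p) (ball (snd (c p) p) (\<rho> * r p))" for p \<rho>
  define A where "A p = chart_preimage (c p) (cball (snd (c p) p) (2 * r p))" for p
  have openV: "openin M (V p \<rho>)" if "p \<in> topspace M" for p \<rho>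
    unfolding V_def using good(1)[OF that] by (intro openin_chart_preimage) auto
  have pV: "p \<in> V p 1" if "p \<in> topspace M" for p
    unfolding V_def chart_preimage_def using good(2,3)[OF that] by simp
  have "compactin M (topspace M)"
    using manifold by (simp add: closed_manifold_def compact_space_def)
  moreover have "\<And>W. W \<in> (\<lambda>p. V p 1) ` topspace M \<Longrightarrow> openin M W" "topspace M \<subseteq> \<Union>((\<lambda>p. V p 1) ` topspace M)"
    using openV pV by blast+
  ultimately obtain \<F> where "finite \<F>" "\<F> \<subseteq> (\<lambda>p. V p 1) ` topspace M" "topspace M \<subseteq> \<Union>\<F>"
    using compactinD by meson
  then obtain J where J: "finite J" "J \<subseteq> topspace M" "topspace M \<subseteq> \<Union>((\<lambda>p. V p 1) ` J)"
    using finite_subset_image[of \<F> "\<lambda>p. V p 1" "topspace M"] by blast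
  have ball2: "cball (snd (c p) p) (2 * r p) \<subseteq> ball (snd (c p) p) (3 * r p)"
    and ball3: "ball (snd (c p) p) (3 * r p) \<subseteq> snd (c p) ` fst (c p)" if "p \<in> J" for p
  proof -
    have p: "p \<in> topspace M" using that J(2) by blast
    show "cball (snd (c p) p) (2 * r p) \<subseteq> ball (snd (c p) p) (3 * r p)"
      using good(3)[OF p] by auto
    show "ball (snd (c p) p) (3 * r p) \<subseteq> snd (c p) ` fst (c p)"
      using good(5)[OF p] ball_subset_cball by (rule order_trans[rotated])
  qed
  have closedA: "closedin M (A p)" if "p \<in> J" for p
    unfolding A_def using good(1)[of p] J(2) that ball2[OF that] ball3[OF that]
    by (intro closedin_chart_preimage compact_cball_model) auto
  have AV: "A p \<subseteq> V p 3" if "p \<in> J" for p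
    unfolding A_def V_def chart_preimage_def using ball2[OF that] by blast
  have contractible: "contractible_space (subtopology M (V p 3))" if "p \<in> J" for p
    unfolding V_def using good(1)[of p] J(2) that ball3[OF that]
    by (intro contractible_chart_preimage convex_ball) auto
  \<comment> \<open>A path leaving the closed ball of radius \<open>2 * r p\<close> after starting
    in the ball of radius \<open>r p\<close> has length at least \<open>m p * r p\<close>. Halving
    makes \<delta> strictly smaller than all these numbers, and the inserted 1 makes the minimum
    meaningful for empty \<open>J\<close>.\<close>
  define \<delta> where "\<delta> = Min (insert 1 ((\<lambda>p. m p * r p) ` J)) / 2"
  have "0 < Min (insert 1 ((\<lambda>p. m p * r p) ` J))"
    using J(1,2) good(3,4) by (subst Min_gr_iff) auto
  then have \<delta>: "0 < \<delta>" "\<delta> < Min (insert 1 ((\<lambda>p. m p * r p) ` J))"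
    by (simp_all add: \<delta>_def)
  have \<delta>_less: "\<delta> < m p * r p" if "p \<in> J" for p
    using \<delta>(2) that J(1) by simp
  obtain n where n: "L < real n * \<delta>"
    using reals_Archimedean3[OF \<delta>(1)] by blast
  obtain C where C: "finite C"
    "\<And>\<sigma> \<sigma>'. pathin M \<sigma> \<Longrightarrow> pathin M \<sigma>' \<Longrightarrow> \<sigma> 0 = \<sigma>' 0 \<Longrightarrow> \<sigma> 1 = \<sigma>' 1 \<Longrightarrow>
       subdivided_path \<sigma> (A ` J) n \<Longrightarrow> subdivided_path \<sigma>' (A ` J) n \<Longrightarrow>
       \<exists>c\<in>C. homologous_rel 1 M {} (path_chain \<sigma> - path_chain \<sigma>') c"
  proof (rule finitely_many_classes_of_subdivided_paths[of M J A "\<lambda>p. V p 3" n])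
    show "compact_space M"
      using manifold by (simp add: closed_manifold_def)
    show "openin M (V p 3)" if "p \<in> J" for p
      using openV J(2) that by blast
  qed (use locally_path_connected_manifold J(1) closedA AV contractible in auto)
  have "subdivided_path \<sigma> (A ` J) n" if ps: "piecewise_smooth_path M \<A> \<sigma>" and L: "riemannian_length \<A> g \<sigma> \<le> L" for \<sigma>
  proof -
    let ?f = "riemannian_speed \<A> g \<sigma>"
    let ?F = "\<lambda>s. integral {0..s} ?f"
    have "pathin M \<sigma>" using ps by (simp add: piecewise_smooth_path_def)
    then have \<sigma>M: "\<sigma> s \<in> topspace M" if "s \<in> {0..1}" for s
      using that by (auto simp: pathin_def continuous_map_def)
    have int: "?f integrable_on {0..1}" by (rule speed_integrable[OF ps])
    have int': "?f integrable_on {u..v}" if "0 \<le> u" "v \<le> 1" for u v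
      using int by (rule integrable_on_subinterval) (use that in auto)
    have cont: "continuous_on {0..1} ?F"
      by (rule indefinite_integral_continuous_1[OF int])
    have split: "?F u + integral {u..v} ?f = ?F v" if "0 \<le> u" "u \<le> v" "v \<le> 1" for u v
      using that by (intro Henstock_Kurzweil_Integration.integral_combine int') auto
    have mono: "?F u \<le> ?F 1" if "u \<in> {0..1}" for u
      using split[of u 1] that Henstock_Kurzweil_Integration.integral_nonneg[OF int', of u 1]
        riemannian_speed_nonneg[OF \<sigma>M] by auto
    \<comment> \<open>The next division point is where exactly \<delta> more length has been used,
      found by the intermediate value theorem, or 1 if at most \<delta> remains.\<close>
    have step: "\<exists>b\<in>{a..1}. (\<exists>S\<in>A ` J. \<sigma> ` {a..b} \<subseteq> S) \<and> (b = 1 \<or> ?F a + \<delta> \<le> ?F b)" if a: "a \<in> {0..1}" for a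
    proof -
      obtain p where p: "p \<in> J" "\<sigma> a \<in> V p 1"
        using J(3) \<sigma>M[OF a] by blast
      have pM: "p \<in> topspace M" using p J(2) by blast
      have stays: "\<sigma> ` {a..b} \<subseteq> A p" if "b \<in> {a..1}" "?F b \<le> ?F a + \<delta>" for b
        unfolding A_def
      proof (rule short_path_stays_in_chart_ball[OF ps])
        show "cball (snd (c p) p) (2 * r p) \<subseteq> snd (c p) ` fst (c p)"
          using ball2[OF p(1)] ball3[OF p(1)] by blast
        show "\<sigma> a \<in> chart_preimage (c p) (ball (snd (c p) p) (r p))"
          using p(2) by (simp add: V_def)
        show "integral {a..b} ?f < m p * r p"
          using split[of a b] that a \<delta>_less[OF p(1)] by auto
      qed (use a that good[OF pM] lower[OF pM] in auto)
      show ?thesis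
      proof (cases "?F 1 \<le> ?F a + \<delta>")
        case True
        then show ?thesis using stays[of 1] a p(1) by (intro bexI[of _ 1]) auto
      next
        case False
        have "continuous_on {a..1} ?F"
          using cont by (rule continuous_on_subset) (use a in auto)
        then obtain b where "a \<le> b" "b \<le> 1" "?F b = ?F a + \<delta>"
          using IVT'[of ?F a "?F a + \<delta>" 1] False \<delta>(1) a by auto
        then show ?thesis using stays[of b] p(1) by (intro bexI[of _ b]) auto
      qed
    qed
    have "?F 1 \<le> L"
      using L by (simp add: riemannian_length_def)
    then have "?F a \<le> L" if "a \<in> {0..1}" for a
      using mono[OF that] by simp
    then obtain t :: "nat \<Rightarrow> real" where "t 0 = 0" "t n = 1"
        "\<And>k. t k \<le> t (Suc k) \<and> (\<exists>S\<in>A ` J. \<sigma> ` {t k..t (Suc k)} \<subseteq> S)"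
      using greedy_subdivision[of "\<lambda>a b. \<exists>S\<in>A ` J. \<sigma> ` {a..b} \<subseteq> S" ?F \<delta> L n, OF step _ _ n] by auto
    then show ?thesis
      unfolding subdivided_path_def by blast
  qed
  then show ?thesis
    using C that[of C] by (simp add: piecewise_smooth_path_def)
qed

end

section \<open>Closing classes\<close>

lemma path_chain_cong:
  assumes "\<And>s. s \<in> {0..1} \<Longrightarrow> f s = h s"
  shows "path_chain f = path_chain h"
proof -
  have "u 1 \<in> {0..1}" if "u \<in> standard_simplex 1" for u :: "nat \<Rightarrow> real"
    using that by (simp add: standard_simplex_def)
  then have "path_simplex f = path_simplex h"
    unfolding path_simplex_def using assms by (intro restrict_ext) simp
  then show ?thesis by (simp add: path_chain_def)
qed

lemma pathin_closed_up_path: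
  assumes x: "continuous_map (top_of_set {0..}) M x" and "0 < t"
    and \<gamma>: "pathin M (\<gamma> (x t) (x 0))" "\<gamma> (x t) (x 0) 0 = x t"
  shows "pathin M (closed_up_path \<gamma> x t)"
  unfolding pathin_def closed_up_path_def[abs_def]
proof (rule continuous_map_cases_le)
  let ?I = "top_of_set {0..1::real}"
  have first: "subtopology ?I {s \<in> topspace ?I. s \<le> 1 / 2} = top_of_set {0..1 / 2}"
    and second: "subtopology ?I {s \<in> topspace ?I. 1 / 2 \<le> s} = top_of_set {1 / 2..1}"
    by (auto simp: subtopology_subtopology intro!: arg_cong[of _ _ "subtopology euclidean"])
  have "continuous_on {0..1 / 2} (\<lambda>s. 2 * s * t)" "continuous_on {1 / 2..1} (\<lambda>s. 2 * s - 1 :: real)"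
    by (intro continuous_intros)+
  then have "continuous_map (top_of_set {0..1 / 2}) (top_of_set {0..}) (\<lambda>s. 2 * s * t)"
    "continuous_map (top_of_set {1 / 2..1}) ?I (\<lambda>s. 2 * s - 1)"
    using \<open>0 < t\<close> by (simp_all add: Pi_iff)
  from continuous_map_compose[OF this(1) x] continuous_map_compose[OF this(2) \<gamma>(1)[unfolded pathin_def]]
  show "continuous_map (subtopology ?I {s \<in> topspace ?I. s \<le> 1 / 2}) M (\<lambda>s. x (2 * s * t))"
    "continuous_map (subtopology ?I {s \<in> topspace ?I. 1 / 2 \<le> s}) M (\<lambda>s. \<gamma> (x t) (x 0) (2 * s - 1))"
    unfolding first second by (simp_all only: comp_def)
  show "x (2 * s * t) = \<gamma> (x t) (x 0) (2 * s - 1)" if "s \<in> topspace ?I" "s = 1 / 2" for s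
  proof -
    have "2 * s = 1" using that(2) by simp
    then show ?thesis using \<gamma>(2) by (simp only:) simp
  qed
qed (simp_all add: continuous_map_from_subtopology)

text \<open>Cutting at 1/2 separates the trajectory from the closing path, up to affine
  reparametrization. The trajectory term is the same for every closing family and therefore drops
  out of differences.\<close>

lemma path_chain_closed_up_path:
  assumes x: "continuous_map (top_of_set {0..}) M x" and "0 < t"
    and \<gamma>: "pathin M (\<gamma> (x t) (x 0))" "\<gamma> (x t) (x 0) 0 = x t"
  shows "homologous_rel 1 M {} (path_chain (closed_up_path \<gamma> x t))
           (path_chain (\<lambda>s. x (s * t)) + path_chain (\<gamma> (x t) (x 0)))"
proof -
  let ?\<Gamma> = "closed_up_path \<gamma> x t"
  have "path_chain (path_segment ?\<Gamma> 0 (1 / 2)) = path_chain (\<lambda>s. x (s * t))"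
    by (rule path_chain_cong) (simp add: path_segment_def closed_up_path_def)
  moreover have "path_chain (path_segment ?\<Gamma> (1 / 2) 1) = path_chain (\<gamma> (x t) (x 0))"
    using \<gamma>(2) by (intro path_chain_cong) (auto simp: path_segment_def closed_up_path_def field_simps)
  moreover have "path_chain (path_segment ?\<Gamma> 0 1) = path_chain ?\<Gamma>"
    by (simp add: path_segment_def[abs_def])
  ultimately have "homologous_rel 1 M {} (path_chain (\<lambda>s. x (s * t)) + path_chain (\<gamma> (x t) (x 0))) (path_chain ?\<Gamma>)"
    using path_chain_subdivide[OF pathin_closed_up_path[where \<gamma> = \<gamma>, OF assms(1,2) \<gamma>], of 0 "1 / 2" 1]
    by (simp add: homologous_rel_def)
  then show ?thesis
    by (simp only: homologous_rel_sym)
qed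

lemma closing_class_eq:
  "0 < t \<Longrightarrow> closing_class M \<gamma> x t = homology_class 1 M (real_chain (path_chain (closed_up_path \<gamma> x t)))"
  by (simp add: closing_class_def path_class_def path_chain_def real_chain_frag_of)

text \<open>Invariance under bounded perturbations is formulated for processes with values in
  homology, so membership has to be known separately from the bound.\<close>

lemma closing_class_in_real_homology:
  assumes x: "continuous_map (top_of_set {0..}) M x" and "0 \<le> t"
    and \<gamma>: "pathin M (\<gamma> (x t) (x 0))" "\<gamma> (x t) (x 0) 0 = x t" "\<gamma> (x t) (x 0) 1 = x 0"
  shows "closing_class M \<gamma> x t \<in> real_homology 1 M"
proof (cases "t = 0")
  case False
  then have "0 < t" using \<open>0 \<le> t\<close> by simp
  then have "pathin M (closed_up_path \<gamma> x t)"
    using assms by (intro pathin_closed_up_path)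
  moreover have "closed_up_path \<gamma> x t 0 = closed_up_path \<gamma> x t 1"
    using \<gamma>(3) by (simp add: closed_up_path_def)
  ultimately have "Poly_Mapping.single (path_simplex (closed_up_path \<gamma> x t)) 1 \<in> real_cycles 1 M"
    by (rule path_simplex_in_real_cycles)
  then show ?thesis
    using False by (simp add: closing_class_def path_class_def real_homology_def)
qed (simp add: closing_class_def homology_zero_in_real_homology)

context riemannian_manifold
begin

text \<open>The larger of the two length bounds governs both families, so a single finite set
  \<open>D\<close> works for all continuous paths and all times.\<close>

lemma finitely_many_closing_class_differences:
  assumes \<gamma>: "borel_closing_family M \<A> g \<gamma>" and \<gamma>': "borel_closing_family M \<A> g \<gamma>'"
  obtains D where "finite D"
    and "\<And>x t. continuous_map (top_of_set {0..}) M x \<Longrightarrow> 0 \<le> t \<Longrightarrow>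
           homology_diff (closing_class M \<gamma> x t) (closing_class M \<gamma>' x t) \<in> D"
proof -
  obtain L L' where L: "\<And>p q. p \<in> topspace M \<Longrightarrow> q \<in> topspace M \<Longrightarrow> riemannian_length \<A> g (\<gamma> p q) \<le> L"
    and L': "\<And>p q. p \<in> topspace M \<Longrightarrow> q \<in> topspace M \<Longrightarrow> riemannian_length \<A> g (\<gamma>' p q) \<le> L'"
    using \<gamma> \<gamma>' unfolding borel_closing_family_def by metis
  have family: "piecewise_smooth_path M \<A> (\<gamma> p q)" "\<gamma> p q 0 = p" "\<gamma> p q 1 = q"
    "piecewise_smooth_path M \<A> (\<gamma>' p q)" "\<gamma>' p q 0 = p" "\<gamma>' p q 1 = q"
    if "p \<in> topspace M" "q \<in> topspace M" for p q
    using \<gamma> \<gamma>' that unfolding borel_closing_family_def by simp_all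
  obtain C where C: "finite C"
    "\<And>\<sigma> \<sigma>'. piecewise_smooth_path M \<A> \<sigma> \<Longrightarrow> piecewise_smooth_path M \<A> \<sigma>' \<Longrightarrow>
       \<sigma> 0 = \<sigma>' 0 \<Longrightarrow> \<sigma> 1 = \<sigma>' 1 \<Longrightarrow>
       riemannian_length \<A> g \<sigma> \<le> max L L' \<Longrightarrow> riemannian_length \<A> g \<sigma>' \<le> max L L' \<Longrightarrow>
       \<exists>c\<in>C. homologous_rel 1 M {} (path_chain \<sigma> - path_chain \<sigma>') c"
    using finitely_many_classes_of_bounded_length[of "max L L'"] by metis
  \<comment> \<open>The inserted element accounts for \<open>t = 0\<close>, where both classes are
    zero by convention instead of coming from a closed-up path.\<close>
  let ?D = "insert (homology_diff (homology_zero 1 M) (homology_zero 1 M))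
              ((\<lambda>c. homology_class 1 M (real_chain c)) ` C)"
  show ?thesis
  proof (rule that)
    show "finite ?D" using C(1) by simp
    fix x :: "real \<Rightarrow> 'a" and t :: real
    assume x: "continuous_map (top_of_set {0..}) M x" and t: "0 \<le> t"
    show "homology_diff (closing_class M \<gamma> x t) (closing_class M \<gamma>' x t) \<in> ?D"
    proof (cases "t = 0")
      case True
      then show ?thesis by (simp add: closing_class_def)
    next
      case False
      then have "0 < t" using t by simp
      have xM: "x t \<in> topspace M" "x 0 \<in> topspace M"
        using x t by (auto simp: continuous_map_def)
      note \<sigma> = family[OF xM]
      let ?\<sigma> = "\<gamma> (x t) (x 0)" and ?\<sigma>' = "\<gamma>' (x t) (x 0)"
      let ?\<Gamma> = "closed_up_path \<gamma> x t" and ?\<Gamma>' = "closed_up_path \<gamma>' x t"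
      have "\<exists>c\<in>C. homologous_rel 1 M {} (path_chain ?\<sigma> - path_chain ?\<sigma>') c"
      proof (rule C(2))
        show "riemannian_length \<A> g ?\<sigma> \<le> max L L'" "riemannian_length \<A> g ?\<sigma>' \<le> max L L'"
          using L[OF xM] L'[OF xM] by auto
      qed (simp_all add: \<sigma>)
      then obtain c where c: "c \<in> C" "homologous_rel 1 M {} (path_chain ?\<sigma> - path_chain ?\<sigma>') c"
        by blast
      have "pathin M ?\<sigma>" "pathin M ?\<sigma>'"
        using \<sigma>(1,4) by (simp_all add: piecewise_smooth_path_def)
      then have "homologous_rel 1 M {} (path_chain ?\<Gamma> - path_chain ?\<Gamma>')
          ((path_chain (\<lambda>s. x (s * t)) + path_chain ?\<sigma>) - (path_chain (\<lambda>s. x (s * t)) + path_chain ?\<sigma>'))"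
        using \<sigma> by (intro homologous_rel_diff path_chain_closed_up_path[OF x \<open>0 < t\<close>]) simp_all
      then have "homologous_rel 1 M {} (path_chain ?\<Gamma> - path_chain ?\<Gamma>') c"
        using c(2) homologous_rel_trans by (simp only: add_diff_cancel_left) blast
      then have "real_chain (path_chain ?\<Gamma> - path_chain ?\<Gamma>' - c) \<in> real_boundaries 1 M"
        unfolding homologous_rel_def by (rule real_chain_in_real_boundaries)
      then have "homology_class 1 M (real_chain (path_chain ?\<Gamma>) - real_chain (path_chain ?\<Gamma>'))
          = homology_class 1 M (real_chain c)"
        by (intro homology_class_eqI) (simp add: real_chain_diff)
      then have "homology_diff (closing_class M \<gamma> x t) (closing_class M \<gamma>' x t) = homology_class 1 M (real_chain c)"
        by (simp only: closing_class_eq[OF \<open>0 < t\<close>] homology_diff_class)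
      then show ?thesis using c(1) by blast
    qed
  qed
qed

end

theorem corollary5p3:
  fixes M :: "'a topology"
    and \<A> :: "('a, 'e::real_inner) chart set"
    and g :: "('a, 'e) metric_field"
    and N :: "'a rchain set \<Rightarrow> real"
    and P :: "'w measure"
    and F :: "real \<Rightarrow> 'w measure"
    and X :: "real \<Rightarrow> 'w \<Rightarrow> 'a"
    and \<gamma> \<gamma>' :: "'a \<Rightarrow> 'a \<Rightarrow> real \<Rightarrow> 'a"
  assumes "closed_connected_riemannian_manifold M \<A> g"
    and "homology_norm 1 M N"
    and "filtered_prob_space P F"
    and "continuous_semimartingale_on P F M \<A> X"
    and "borel_closing_family M \<A> g \<gamma>"
    and "borel_closing_family M \<A> g \<gamma>'"
  defines "H \<equiv> \<lambda>\<omega>. closing_class M \<gamma> (\<lambda>t. X t \<omega>)"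
    and "H' \<equiv> \<lambda>\<omega>. closing_class M \<gamma>' (\<lambda>t. X t \<omega>)"
  shows "(\<forall>\<omega>\<in>space P. bdd_above ((\<lambda>t. N (homology_diff (H \<omega> t) (H' \<omega> t))) ` {0..})) \<and>
         (\<forall>\<Phi>. unchanged_by_bounded_perturbations (space P) M N \<Phi> \<longrightarrow> \<Phi> H = \<Phi> H')"
proof -
  interpret riemannian_manifold M \<A> g
    using assms(1) by unfold_locales (simp_all add: closed_connected_riemannian_manifold_def)
  have X: "continuous_map (top_of_set {0..}) M (\<lambda>t. X t \<omega>)" if "\<omega> \<in> space P" for \<omega>
    using assms(4) that by (simp add: continuous_semimartingale_on_def continuous_adapted_def)
  obtain D where D: "finite D" "\<And>x t. continuous_map (top_of_set {0..}) M x \<Longrightarrow> 0 \<le> t \<Longrightarrow>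
      homology_diff (closing_class M \<gamma> x t) (closing_class M \<gamma>' x t) \<in> D"
    using finitely_many_closing_class_differences[OF assms(5,6)] by metis
  have bounded: "bdd_above ((\<lambda>t. N (homology_diff (H \<omega> t) (H' \<omega> t))) ` {0..})" if "\<omega> \<in> space P" for \<omega>
  proof (rule bdd_above_mono)
    show "bdd_above (N ` D)" using D(1) by simp
    show "(\<lambda>t. N (homology_diff (H \<omega> t) (H' \<omega> t))) ` {0..} \<subseteq> N ` D"
      using D(2)[OF X[OF that]] by (auto simp: H_def H'_def)
  qed
  have "H \<omega> t \<in> real_homology 1 M \<and> H' \<omega> t \<in> real_homology 1 M" if "\<omega> \<in> space P" "0 \<le> t" for \<omega> t
  proof -
    have "X t \<omega> \<in> topspace M" "X 0 \<omega> \<in> topspace M"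
      using X[OF that(1)] that(2) by (auto simp: continuous_map_def)
    then have "pathin M (\<delta> (X t \<omega>) (X 0 \<omega>)) \<and> \<delta> (X t \<omega>) (X 0 \<omega>) 0 = X t \<omega> \<and> \<delta> (X t \<omega>) (X 0 \<omega>) 1 = X 0 \<omega>"
      if "borel_closing_family M \<A> g \<delta>" for \<delta>
      using that by (simp add: borel_closing_family_def piecewise_smooth_path_def)
    then show ?thesis
      unfolding H_def H'_def using assms(5,6) X[OF that(1)] that(2)
      by (intro conjI closing_class_in_real_homology) simp_all
  qed
  then have perturbation: "\<forall>\<omega>\<in>space P. (\<forall>t\<ge>0. H \<omega> t \<in> real_homology 1 M \<and> H' \<omega> t \<in> real_homology 1 M) \<and>
      bounded_perturbation N (H \<omega>) (H' \<omega>)"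
    using bounded by (simp add: bounded_perturbation_def)
  have unchanged: "\<Phi> H = \<Phi> H'" if "unchanged_by_bounded_perturbations (space P) M N \<Phi>" for \<Phi>
    using that[unfolded unchanged_by_bounded_perturbations_def, THEN spec[of _ H], THEN spec[of _ H']] perturbation
    by (rule mp)
  show ?thesis
    by (intro conjI ballI allI impI bounded unchanged)
qed

end
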